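(* Let $\{v(t)\}_{t\in\mathbb{Z}_{\ge 0}}\subset\mathcal{V}_N$ be an evolution of the gossip coverage algorithm, i.e. $$v(t+1)=T_{\sigma(t)}(v(t)),\qquad t\in\mathbb{Z}_{\ge 0},$$ where $\sigma:\mathbb{Z}_{\ge 0}\to\{(i,j)\in\{1,\dots,N\}^2 \mid i\neq j\}$ is either a deterministic map or a stochastic process. Then: (i) if $\sigma$ is a uniformly persistent map, then each non-degenerate evolution $v$ converges to the set of centroidal Voronoi partitions; and (ii) if $\sigma$ is a randomly persistent stochastic process, then each evolution $v$, conditioned upon being non-degenerate, converges almost surely to the set of centroidal Voronoi partitions (that is, almost surely on the event that the evolution is non-degenerate, it converges to the set of centroidal Voronoi partitions).
   Context: Environment: $Q\subset\mathbb{R}^2$ is compact and convex with non-empty interior; $N\ge 2$; $\mu$ is Lebesgue measure. $\phi:Q\to\mathbb{R}_{>0}$ is bounded and measurable; $f:\mathbb{R}_{\ge0}\to\mathbb{R}_{\ge0}$ is locally Lipschitz, (strictly) increasing and convex. Partitions: an $N$-partition of $Q$ is an ordered collection $v=(v_i)_{i=1}^N$ of subsets of $Q$ such that $\bigcup_i v_i=Q$; $\operatorname{int}(v_i)\cap\operatorname{int}(v_j)=\emptyset$ for $i\ne j$; and each $v_i$ is closed with non-empty interior. $\mathcal{V}_N$ is the set of $N$-partitions of $Q$. Centroid: for $p\in Q$ and compact $A\subset Q$ let $\mathcal{H}_1(p;A)=\int_A f(\|p-q\|)\phi(q)\,dq$. For compact $A\subset Q$ with $\mu(A)>0$, $\operatorname{Cd}(A)$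 is the unique minimizer over $p\in Q$ of $\mathcal{H}_1(p;A)$. Write $\operatorname{Cd}(v)=(\operatorname{Cd}(v_1),\dots,\operatorname{Cd}(v_N))$. Voronoi partitions: for pairwise distinct $p_1,\dots,p_N\in Q$, $V(p)=(V_i(p))_{i=1}^N$ with $V_i(p)=\{q\in Q\mid \|q-p_i\|\le\|q-p_j\|\ \text{for all } j\ne i\}$. A partition $v\in\mathcal{V}_N$ is centroidal Voronoi if $\operatorname{Cd}(v_i)\ne\operatorname{Cd}(v_j)$ for all $i\neq j$ and $v=V(\operatorname{Cd}(v))$. Gossip map: for distinct points $q_1,q_2$, let $H(q_1;q_2)=\{q\mid \|q-q_1\|\le\|q-q_2\|\}$. For $i\ne j$ and $v\in\mathcal{V}_N$: $T_{ij}(v)=v$ if $\operatorname{Cd}(v_i)=\operatorname{Cd}(v_j)$; otherwise $T_{ij}(v)$ is obtained from $v$ by replacing $v_i$ with $(v_i\cup v_j)\cap H(\operatorname{Cd}(v_i);\operatorname{Cd}(v_j))$ and $v_j$ with $(v_i\cup v_j)\cap H(\operatorname{Cd}(v_j);\operatorname{Cd}(v_i))$, all other components unchanged. Non-degeneracy: a sequence $\{v(t)\}$ in $\mathcal{V}_N$ is non-degenerate if it is (a) distinct centroidal: there is $\epsilon>0$ with $\|\operatorname{Cd}(v_i(t))-\operatorname{Cd}(v_j(t))\|\ge\epsilon$ for all $t$ and $i\ne j$; (b) non-vanishing: there is $\epsilon>0$ with $\mu(v_i(t))>\epsilon$ for all $t,i$; and (c) finitely convex: there is $\ell\in\mathbb{N}$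 such that for all $t,i$ the set $v_i(t)$ is the union of at most $\ell$ convex sets. Persistency: let $X$ be a finite set. A map $\sigma:\mathbb{Z}_{\ge0}\to X$ is uniformly persistent if there is $\Delta\in\mathbb{N}$ such that for each $x\in X$ there is an increasing sequence of times $\{t_k\}_{k\in\mathbb{Z}_{\ge0}}\subset\mathbb{Z}_{\ge 0}$ with $t_{k+1}-t_k\le\Delta$ and $\sigma(t_k)=x$ for all $k$. A stochastic process $\sigma:\mathbb{Z}_{\ge0}\to X$ is randomly persistent if there are $p\in\,]0,1[$ and $\Delta\in\mathbb{N}$ such that for each $x\in X$ and each $t\in\mathbb{Z}_{\ge0}$ there is $k\in\{1,\dots,\Delta\}$ with $\mathbb{P}[\sigma(t+k)=x\mid\sigma(t),\dots,\sigma(1)]\ge p$. Convergence: $d_\ominus(u,v)=\sum_{i=1}^N\mu\big((u_i\cup v_i)\setminus(u_i\cap v_i)\big)$. A sequence $\{v(t)\}\subset\mathcal{V}_N$ converges to a set $X\subset\mathcal{V}_N$ if $\lim_{t\to\infty}\inf\{d_\ominus(v(t),x)\mid x\in X\}=0$. *)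

theory Defs
  imports "HOL-Analysis.Analysis" "HOL-Probability.Probability"
begin

text \<open>
  The \<open>N\<close> regions are indexed by a finite type \<open>'n\<close> with \<open>N = CARD('n)\<close>. The parameters \<open>Q\<close>,
  \<open>\<phi>\<close>, \<open>f\<close> are the environment, the density (relevant on \<open>Q\<close> only) and the cost (relevant on
  nonnegative arguments only).
\<close>

definition partitions :: "(real^2) set \<Rightarrow> ('n::finite \<Rightarrow> (real^2) set) set" where
  "partitions Q =
    {v. (\<forall>i. v i \<subseteq> Q) \<and> (\<Union>i. v i) = Q \<and>
        (\<forall>i j. i \<noteq> j \<longrightarrow> interior (v i) \<inter> interior (v j) = {}) \<and>
        (\<forall>i. closed (v i) \<and> interior (v i) \<noteq> {})}"

definition H1 ::
    "(real^2 \<Rightarrow> real) \<Rightarrow> (real \<Rightarrow> real) \<Rightarrow> real^2 \<Rightarrow> (real^2) set \<Rightarrow> real" where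
  "H1 \<phi> f p A = (LINT q:A|lebesgue. f (norm (p - q)) * \<phi> q)"

text \<open>Only meaningful for compact \<open>A \<subseteq> Q\<close> of positive measure, where the minimizer exists and is
  unique.\<close>

definition Cd ::
    "(real^2) set \<Rightarrow> (real^2 \<Rightarrow> real) \<Rightarrow> (real \<Rightarrow> real) \<Rightarrow> (real^2) set \<Rightarrow> real^2" where
  "Cd Q \<phi> f A = (THE p. is_arg_min (\<lambda>p. H1 \<phi> f p A) (\<lambda>p. p \<in> Q) p)"

definition voronoi ::
    "(real^2) set \<Rightarrow> ('n::finite \<Rightarrow> real^2) \<Rightarrow> 'n \<Rightarrow> (real^2) set" where
  "voronoi Q p i = {q \<in> Q. \<forall>j. j \<noteq> i \<longrightarrow> norm (q - p i) \<le> norm (q - p j)}"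

definition centroidal_voronoi ::
    "(real^2) set \<Rightarrow> (real^2 \<Rightarrow> real) \<Rightarrow> (real \<Rightarrow> real) \<Rightarrow> ('n::finite \<Rightarrow> (real^2) set) set" where
  "centroidal_voronoi Q \<phi> f =
    {v \<in> partitions Q.
      (\<forall>i j. i \<noteq> j \<longrightarrow> Cd Q \<phi> f (v i) \<noteq> Cd Q \<phi> f (v j)) \<and>
      v = voronoi Q (\<lambda>i. Cd Q \<phi> f (v i))}"

definition halfplane :: "real^2 \<Rightarrow> real^2 \<Rightarrow> (real^2) set" where
  "halfplane q1 q2 = {q. norm (q - q1) \<le> norm (q - q2)}"

definition gossip_map ::
    "(real^2) set \<Rightarrow> (real^2 \<Rightarrow> real) \<Rightarrow> (real \<Rightarrow> real) \<Rightarrow> 'n \<times> 'n \<Rightarrow>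
     ('n::finite \<Rightarrow> (real^2) set) \<Rightarrow> ('n \<Rightarrow> (real^2) set)" where
  "gossip_map Q \<phi> f = (\<lambda>(i, j) v.
    let a = Cd Q \<phi> f (v i); b = Cd Q \<phi> f (v j) in
    if a = b then v
    else v(i := (v i \<union> v j) \<inter> halfplane a b, j := (v i \<union> v j) \<inter> halfplane b a))"

definition gossip_pairs :: "('n::finite \<times> 'n) set" where
  "gossip_pairs = {(i, j). i \<noteq> j}"

definition gossip_evolution ::
    "(real^2) set \<Rightarrow> (real^2 \<Rightarrow> real) \<Rightarrow> (real \<Rightarrow> real) \<Rightarrow> (nat \<Rightarrow> 'n \<times> 'n) \<Rightarrow>
     (nat \<Rightarrow> 'n::finite \<Rightarrow> (real^2) set) \<Rightarrow> bool" where
  "gossip_evolution Q \<phi> f \<sigma> v \<longleftrightarrow>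
    (\<forall>t. v t \<in> partitions Q) \<and> (\<forall>t. v (Suc t) = gossip_map Q \<phi> f (\<sigma> t) (v t))"

definition nondegenerate ::
    "(real^2) set \<Rightarrow> (real^2 \<Rightarrow> real) \<Rightarrow> (real \<Rightarrow> real) \<Rightarrow>
     (nat \<Rightarrow> 'n::finite \<Rightarrow> (real^2) set) \<Rightarrow> bool" where
  "nondegenerate Q \<phi> f v \<longleftrightarrow>
    (\<exists>\<epsilon>>0. \<forall>t i j. i \<noteq> j \<longrightarrow> norm (Cd Q \<phi> f (v t i) - Cd Q \<phi> f (v t j)) \<ge> \<epsilon>) \<and>
    (\<exists>\<epsilon>>0. \<forall>t i. measure lebesgue (v t i) > \<epsilon>) \<and>
    (\<exists>l::nat. \<forall>t i. \<exists>\<C>. finite \<C> \<and> card \<C> \<le> l \<and> (\<forall>C\<in>\<C>. convex C) \<and> v t i = \<Union>\<C>)"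

definition uniformly_persistent :: "'x set \<Rightarrow> (nat \<Rightarrow> 'x) \<Rightarrow> bool" where
  "uniformly_persistent X \<sigma> \<longleftrightarrow>
    finite X \<and> (\<forall>t. \<sigma> t \<in> X) \<and>
    (\<exists>\<Delta>::nat. \<forall>x\<in>X. \<exists>\<tau>::nat \<Rightarrow> nat. strict_mono \<tau> \<and>
       (\<forall>k. \<tau> (Suc k) - \<tau> k \<le> \<Delta> \<and> \<sigma> (\<tau> k) = x))"

text \<open>The \<open>\<sigma>\<close>-algebra generated by \<open>\<sigma>(1), \<dots>, \<sigma>(t)\<close>; for \<open>t = 0\<close> it is trivial.\<close>

definition history_algebra ::
    "'w measure \<Rightarrow> 'x set \<Rightarrow> (nat \<Rightarrow> 'w \<Rightarrow> 'x) \<Rightarrow> nat \<Rightarrow> 'w measure" where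
  "history_algebra M X \<sigma> t =
    vimage_algebra (space M) (\<lambda>\<omega>. \<lambda>s\<in>{1..t}. \<sigma> s \<omega>) (Pi\<^sub>M {1..t} (\<lambda>_. count_space X))"

text \<open>The conditional probability of an event given \<open>\<sigma>(1), \<dots>, \<sigma>(t)\<close> is the conditional
  expectation of its indicator; as it is defined up to null sets, the bound is required almost
  everywhere. The lag \<open>k\<close> depends on \<open>x\<close> and \<open>t\<close> but not on the history.\<close>

definition randomly_persistent ::
    "'w measure \<Rightarrow> 'x set \<Rightarrow> (nat \<Rightarrow> 'w \<Rightarrow> 'x) \<Rightarrow> bool" where
  "randomly_persistent M X \<sigma> \<longleftrightarrow>
    prob_space M \<and> finite X \<and> (\<forall>t. \<sigma> t \<in> measurable M (count_space X)) \<and>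
    (\<exists>p::real. \<exists>\<Delta>::nat. 0 < p \<and> p < 1 \<and>
      (\<forall>x\<in>X. \<forall>t. \<exists>k\<in>{1..\<Delta>}. AE \<omega> in M.
        real_cond_exp M (history_algebra M X \<sigma> t)
          (indicator {\<omega>' \<in> space M. \<sigma> (t + k) \<omega>' = x}) \<omega> \<ge> p))"

definition d_sym :: "('n::finite \<Rightarrow> (real^2) set) \<Rightarrow> ('n \<Rightarrow> (real^2) set) \<Rightarrow> real" where
  "d_sym u v = (\<Sum>i\<in>UNIV. measure lebesgue ((u i \<union> v i) - (u i \<inter> v i)))"

text \<open>The infimum is taken in the extended reals so that it is \<open>\<infinity>\<close> over an empty set \<open>X\<close>.\<close>

definition converges_to_set ::
    "(nat \<Rightarrow> 'n::finite \<Rightarrow> (real^2) set) \<Rightarrow> ('n \<Rightarrow> (real^2) set) set \<Rightarrow> bool" where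
  "converges_to_set v X \<longleftrightarrow> (\<lambda>t. INF x\<in>X. ereal (d_sym (v t) x)) \<longlonglongrightarrow> 0"

end

theory Submission
  imports Defs
begin

text \<open>
  Write \<open>H v\<close> for the total cost of a partition whose regions are served from their own centroids.
  A gossip step on \<open>(i, j)\<close> lowers \<open>H\<close> by at least the cost saved by handing every point of \<open>v i\<close> that
  is closer to the centroid of \<open>v j\<close> to region \<open>j\<close>, and conversely; call these savings the excesses of
  \<open>v\<close> at \<open>(i, j)\<close> and \<open>(j, i)\<close>. As \<open>H\<close> is nonnegative, the excess at the active pair tends to zero.
  While the centroids stay separated, a small excess forces a small transferred area; this is
  uniform because the centroids range over the compact set \<open>Q\<close>, so no compactness of the space of
  partitions is needed. Hence consecutive partitions become close, and since centroids
  are uniformly continuous in the symmetric difference (for areas bounded below), the excess at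
  each fixed pair varies slowly. If every pair is active within bounded time, all excesses tend to
  zero, and along any subsequence on which the centroids converge the partitions
  approach the Voronoi partition of the limits, whose centroids are these limits by continuity.

  In the random case, if the excess at a pair exceeded a fixed bound infinitely often, a conditional
  Borel--Cantelli argument would almost surely make the pair active within bounded time after infinitely
  many of these instants, which contradicts the slow variation.
\<close>

text \<open>The density is positive but need not be bounded away from zero, and \<open>f\<close>
  need not be strictly convex, so neither the transferred area nor the position of a centroid comes
  with an explicit modulus. Both rest on one principle: if a nonnegative continuous kernel
  \<open>K a b\<close> vanishes only on a null set when \<open>a \<noteq> b\<close>, small cost
  forces small area. For fixed sites this is continuity of the measure along sublevel sets; for
  sites in \<open>Q\<close> at distance at least \<open>\<epsilon>\<close> it follows by
  compactness, because costs are equicontinuous in the sites over all regions. The kernel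
  \<open>gap\<close> vanishes on a bisector and controls the transferred area; \<open>midgap\<close>
  vanishes at most on the line through the sites and controls centroids. In the random case the
  constants of non-degeneracy depend on the sample point, and \<open>v\<close> carries no measurable
  structure. Both obstacles disappear when the Borel-Cantelli events are expressed through past
  active pairs alone; non-degeneracy is used afterwards, path by path.\<close>

lemma negligible_bisector:
  fixes a b :: "'a::euclidean_space"
  assumes "a \<noteq> b"
  shows "negligible {q. norm (a - q) = norm (b - q)}"
proof -
  have "{q. norm (a - q) = norm (b - q)} = {q. (2 *\<^sub>R (b - a)) \<bullet> q = b \<bullet> b - a \<bullet> a}"
    by (auto simp: norm_eq algebra_simps inner_commute)
  then show ?thesis
    using negligible_hyperplane[of "2 *\<^sub>R (b - a)" "b \<bullet> b - a \<bullet> a"] assms by simp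
qed

text \<open>Equality in the triangle inequality makes \<open>a - q\<close> and \<open>b - q\<close>
  parallel, which puts \<open>q\<close> on the line through \<open>a\<close> and \<open>b\<close>;
  \<open>n\<close> is normal to that line. All strictness in the uniqueness of centroids comes from
  here.\<close>

lemma negligible_norm_midpoint_eq:
  fixes a b :: "real^2"
  assumes "a \<noteq> b"
  shows "negligible {q. norm (a - q) + norm (b - q) = norm ((a - q) + (b - q))}"
proof -
  define n :: "real^2" where "n = vector [- (a - b)$2, (a - b)$1]"
  have orth: "n \<bullet> (a - b) = 0"
    by (simp add: n_def inner_vec_def sum_2 algebra_simps)
  have "n \<noteq> 0"
    using assms by (auto simp: n_def vec_eq_iff forall_2)
  have "q \<in> {q. n \<bullet> q = n \<bullet> a}"
    if eq: "norm (a - q) + norm (b - q) = norm ((a - q) + (b - q))" for q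
  proof -
    have *: "norm (a - q) *\<^sub>R (b - q) = norm (b - q) *\<^sub>R (a - q)"
      using eq norm_triangle_eq[of "a - q" "b - q"] by simp
    have "norm (a - q) * (n \<bullet> (b - q)) = norm (b - q) * (n \<bullet> (a - q))"
      using arg_cong[OF *, of "\<lambda>z. n \<bullet> z"] by simp
    moreover have "n \<bullet> (b - q) = n \<bullet> (a - q)"
      using orth by (simp add: inner_diff_right)
    ultimately have "norm (a - q) = norm (b - q) \<or> n \<bullet> (a - q) = 0"
      by auto
    moreover have False if "norm (a - q) = norm (b - q)"
    proof -
      have "norm (a - q) = 0 \<or> b - q = a - q"
        using * that by auto
      then show False
        using that assms by auto
    qed
    ultimately show ?thesis
      by (auto simp: inner_diff_right)
  qed
  then have "{q. norm (a - q) + norm (b - q) = norm ((a - q) + (b - q))} \<subseteq> {q. n \<bullet> q = n \<bullet> a}"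
    by blast
  then show ?thesis
    using negligible_hyperplane[of n "n \<bullet> a"] \<open>n \<noteq> 0\<close> negligible_subset by blast
qed

lemma negligible_frontier_Union_convex:
  fixes S :: "'a::euclidean_space set"
  assumes "finite \<C>" and "\<And>C. C \<in> \<C> \<Longrightarrow> convex C"
  shows "negligible (frontier (\<Union>\<C>))"
proof -
  have "negligible (\<Union>C\<in>\<C>. frontier C)"
    using assms by (intro negligible_Union) (auto intro: negligible_convex_frontier)
  moreover have "frontier (\<Union>\<C>) \<subseteq> (\<Union>C\<in>\<C>. frontier C)"
    by (rule frontier_Union_subset) (use assms in auto)
  ultimately show ?thesis
    using negligible_subset by blast
qed

lemma negligible_Int_of_disjoint_interiors:
  fixes S T :: "'a::euclidean_space set"
  assumes "interior S \<inter> interior T = {}" and "negligible (frontier S)" and "negligible (frontier T)"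
  shows "negligible (S \<inter> T)"
proof -
  have "S \<inter> T \<subseteq> frontier S \<union> frontier T"
    using assms(1) closure_subset by (auto simp: frontier_def)
  then show ?thesis
    using assms(2,3) negligible_Un negligible_subset by blast
qed

lemma convex_halfplane: "convex (halfplane a b)"
proof -
  have "halfplane a b = {q. (2 *\<^sub>R (b - a)) \<bullet> q \<le> b \<bullet> b - a \<bullet> a}"
    by (auto simp: halfplane_def norm_le algebra_simps inner_commute)
  then show ?thesis
    using convex_halfspace_le[of "2 *\<^sub>R (b - a)"] by simp
qed

section \<open>Costs and centroids\<close>

locale coverage =
  fixes Q :: "(real^2) set" and \<phi> :: "real^2 \<Rightarrow> real" and f :: "real \<Rightarrow> real" and B :: real
  assumes compact_Q: "compact Q" and convex_Q: "convex Q" and interior_Q: "interior Q \<noteq> {}"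
    and \<phi>_pos: "q \<in> Q \<Longrightarrow> \<phi> q > 0"
    and \<phi>_le: "q \<in> Q \<Longrightarrow> \<phi> q \<le> B"
    and B_pos: "B > 0"
    and \<phi>_meas: "\<phi> \<in> borel_measurable (lebesgue_on Q)"
    and f_nonneg: "x \<ge> 0 \<Longrightarrow> f x \<ge> 0"
    and f_cont: "continuous_on {0..} f"
    and f_strict: "strict_mono_on {0..} f"
    and f_convex: "convex_on {0..} f"
begin

abbreviation \<mu> :: "(real^2) set \<Rightarrow> real" where "\<mu> \<equiv> measure lebesgue"

definition regions :: "(real^2) set set" where
  "regions = {A. A \<in> sets lebesgue \<and> A \<subseteq> Q}"

text \<open>\<open>H1\<close> with an arbitrary kernel in place of the distance cost, so that
  savings and convexity defects are integrated by the same lemmas as costs.\<close>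

definition cost :: "(real^2 \<Rightarrow> real) \<Rightarrow> (real^2) set \<Rightarrow> real" where
  "cost K A = (LINT q:A|lebesgue. K q * \<phi> q)"

lemma Q_sets [measurable]: "Q \<in> sets lebesgue"
  using compact_Q by (simp add: compact_imp_closed)

lemma Q_lmeasurable: "Q \<in> lmeasurable"
  using compact_Q lmeasurable_compact by blast

lemma regionsD:
  assumes "A \<in> regions"
  shows "A \<in> sets lebesgue" "A \<subseteq> Q" "A \<in> lmeasurable"
  using assms Q_lmeasurable unfolding regions_def
  by (auto intro: fmeasurableI2)

lemma regionsI: "A \<in> sets lebesgue \<Longrightarrow> A \<subseteq> Q \<Longrightarrow> A \<in> regions"
  by (simp add: regions_def)

lemma regions_closed: "closed A \<Longrightarrow> A \<subseteq> Q \<Longrightarrow> A \<in> regions"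
  by (simp add: regions_def)

lemma regions_ops:
  assumes "A \<in> regions" "C \<in> regions"
  shows "A \<union> C \<in> regions" "A \<inter> C \<in> regions" "A - C \<in> regions"
  using assms by (auto simp: regions_def)

lemma regions_Int: "A \<in> regions \<Longrightarrow> C \<in> sets lebesgue \<Longrightarrow> A \<inter> C \<in> regions"
  "A \<in> regions \<Longrightarrow> C \<in> sets lebesgue \<Longrightarrow> A - C \<in> regions"
  by (auto simp: regions_def)

lemma continuous_bounded_Q:
  assumes "continuous_on UNIV (K :: real^2 \<Rightarrow> real)"
  obtains c where "c > 0" "\<And>q. q \<in> Q \<Longrightarrow> \<bar>K q\<bar> \<le> c"
proof -
  have "bounded (K ` Q)"
    using assms compact_Q
    by (meson compact_continuous_image compact_imp_bounded continuous_on_subset subset_UNIV)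
  then show ?thesis
    using that unfolding bounded_pos by auto
qed

lemma integrable_cost:
  assumes K: "continuous_on UNIV K" and A: "A \<in> regions"
  shows "set_integrable lebesgue A (\<lambda>q. K q * \<phi> q)"
proof -
  have [measurable]: "A \<in> sets lebesgue"
    using regionsD[OF A] by simp
  obtain c where c: "c > 0" "\<And>q. q \<in> Q \<Longrightarrow> \<bar>K q\<bar> \<le> c"
    using continuous_bounded_Q[OF K] by blast
  have m1: "(\<lambda>q. indicator Q q *\<^sub>R \<phi> q) \<in> borel_measurable lebesgue"
    using \<phi>_meas Q_sets by (simp add: borel_measurable_restrict_space_iff)
  have m2: "K \<in> borel_measurable lebesgue"
    by (rule measurable_completion) (simp add: borel_measurable_continuous_onI K)
  \<comment> \<open>\<open>\<phi>\<close> is measurable on \<open>Q\<close> only, so it is extended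
    by zero; on \<open>A\<close> the integrand is unchanged.\<close>
  have "(\<lambda>q. indicator A q * K q * (indicator Q q *\<^sub>R \<phi> q)) \<in> borel_measurable lebesgue"
    using m1 m2 by measurable
  moreover have "(\<lambda>q. indicator A q * K q * (indicator Q q *\<^sub>R \<phi> q)) =
      (\<lambda>q. indicator A q *\<^sub>R (K q * \<phi> q))"
    using regionsD(2)[OF A] by (auto simp: indicator_def fun_eq_iff)
  ultimately have m: "(\<lambda>q. indicator A q *\<^sub>R (K q * \<phi> q)) \<in> borel_measurable lebesgue"
    by simp
  have "integrable lebesgue (\<lambda>q. (c * B) * indicator A q)"
    using regionsD(3)[OF A] by (simp add: lmeasurable_iff_integrable)
  then show ?thesis
    unfolding set_integrable_def
  proof (rule Bochner_Integration.integrable_bound[OF _ m])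
    show "AE q in lebesgue. norm (indicator A q *\<^sub>R (K q * \<phi> q)) \<le> norm (c * B * indicator A q)"
    proof (rule AE_I2)
      fix q
      show "norm (indicator A q *\<^sub>R (K q * \<phi> q)) \<le> norm (c * B * indicator A q)"
      proof (cases "q \<in> A")
        case True
        then have "q \<in> Q"
          using regionsD(2)[OF A] by auto
        then have "\<bar>K q\<bar> * \<bar>\<phi> q\<bar> \<le> c * B"
          using c \<phi>_le \<phi>_pos[of q] by (intro mult_mono) auto
        then show ?thesis
          using True c B_pos by (simp add: abs_mult)
      qed simp
    qed
  qed
qed

lemma cost_cong:
  assumes "\<And>q. q \<in> A \<Longrightarrow> K q = K' q" shows "cost K A = cost K' A"
  unfolding cost_def set_lebesgue_integral_def
  by (rule Bochner_Integration.integral_cong) (use assms in \<open>auto simp: indicator_def\<close>)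

lemma cost_add:
  assumes "continuous_on UNIV K" "continuous_on UNIV K'" "A \<in> regions"
  shows "cost (\<lambda>q. K q + K' q) A = cost K A + cost K' A"
  unfolding cost_def
  using set_integral_add(2)[OF integrable_cost[OF assms(1,3)] integrable_cost[OF assms(2,3)]]
  by (simp add: distrib_right)

lemma cost_diff:
  assumes "continuous_on UNIV K" "continuous_on UNIV K'" "A \<in> regions"
  shows "cost (\<lambda>q. K q - K' q) A = cost K A - cost K' A"
  unfolding cost_def
  using set_integral_diff(2)[OF integrable_cost[OF assms(1,3)] integrable_cost[OF assms(2,3)]]
  by (simp add: left_diff_distrib)

lemma cost_cmult: "cost (\<lambda>q. r * K q) A = r * cost K A"
  unfolding cost_def using set_integral_mult_right[of lebesgue A r "\<lambda>q. K q * \<phi> q"]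
  by (simp add: mult.assoc)

lemma cost_Un:
  assumes K: "continuous_on UNIV K" and A: "A \<in> regions" and C: "C \<in> regions"
    and "negligible (A \<inter> C)"
  shows "cost K (A \<union> C) = cost K A + cost K C"
  unfolding cost_def
proof (rule set_integral_Un_AE)
  have "A \<inter> C \<in> null_sets lebesgue"
    using assms(4) by (simp add: negligible_iff_null_sets)
  then show "AE x in lebesgue. \<not> (x \<in> A \<and> x \<in> C)"
    using AE_not_in by fastforce
qed (use assms integrable_cost regionsD in auto)

lemma cost_bound:
  assumes K: "continuous_on UNIV K" and A: "A \<in> regions" and c: "\<And>q. q \<in> A \<Longrightarrow> \<bar>K q\<bar> \<le> c"
  shows "\<bar>cost K A\<bar> \<le> c * B * \<mu> A"
proof (cases "A = {}")
  case True
  then show ?thesis by (simp add: cost_def set_lebesgue_integral_def)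
next
  case False
  then have "c \<ge> 0"
    using c by fastforce
  have "norm (\<integral>q. indicator A q *\<^sub>R (K q * \<phi> q) \<partial>lebesgue) \<le>
      (\<integral>q. (c * B) * indicator A q \<partial>lebesgue)"
  proof (rule Bochner_Integration.integral_norm_bound_integral)
    show "integrable lebesgue (\<lambda>q. indicator A q *\<^sub>R (K q * \<phi> q))"
      using integrable_cost[OF K A] by (simp add: set_integrable_def)
    show "integrable lebesgue (\<lambda>q. (c * B) * indicator A q)"
      using regionsD(3)[OF A] by (simp add: lmeasurable_iff_integrable)
    fix q
    show "norm (indicator A q *\<^sub>R (K q * \<phi> q)) \<le> c * B * indicator A q"
    proof (cases "q \<in> A")
      case True
      then have "q \<in> Q"
        using regionsD(2)[OF A] by auto
      then have "\<bar>K q\<bar> * \<bar>\<phi> q\<bar> \<le> c * B"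
        using c[OF True] \<phi>_le \<phi>_pos[of q] \<open>c \<ge> 0\<close> by (intro mult_mono) auto
      then show ?thesis
        using True by (simp add: abs_mult)
    qed simp
  qed
  then show ?thesis
    by (simp add: cost_def set_lebesgue_integral_def)
qed

lemma cost_nonneg:
  assumes "\<And>q. q \<in> A \<Longrightarrow> K q \<ge> 0" and A: "A \<in> regions"
  shows "cost K A \<ge> 0"
  unfolding cost_def set_lebesgue_integral_def
proof (rule Bochner_Integration.integral_nonneg)
  show "0 \<le> indicator A q *\<^sub>R (K q * \<phi> q)" for q
    using assms(1)[of q] \<phi>_pos[of q] regionsD(2)[OF A] by (auto simp: indicator_def)
qed

lemma cost_subset:
  assumes K: "continuous_on UNIV K" and A: "A \<in> regions" and C: "C \<in> regions" and "C \<subseteq> A"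
    and "\<And>q. q \<in> A \<Longrightarrow> K q \<ge> 0"
  shows "cost K C \<le> cost K A"
proof -
  have "cost K (C \<union> (A - C)) = cost K C + cost K (A - C)"
    by (rule cost_Un) (use assms regions_ops in auto)
  moreover have "cost K (A - C) \<ge> 0"
    using assms regions_ops by (intro cost_nonneg) auto
  moreover have "C \<union> (A - C) = A"
    using assms by auto
  ultimately show ?thesis by simp
qed

lemma cost_symdiff_le:
  assumes K: "continuous_on UNIV K" and A: "A \<in> regions" and C: "C \<in> regions"
    and c: "\<And>q. q \<in> Q \<Longrightarrow> \<bar>K q\<bar> \<le> c"
  shows "\<bar>cost K A - cost K C\<bar> \<le> c * B * \<mu> ((A \<union> C) - (A \<inter> C))"
proof -
  have AC: "A - C \<in> regions" "C - A \<in> regions" "A \<inter> C \<in> regions"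
    using A C regions_ops by auto
  have "cost K ((A - C) \<union> (A \<inter> C)) = cost K (A - C) + cost K (A \<inter> C)"
    by (rule cost_Un) (use K AC in \<open>auto intro: negligible_subset[of "{}"]\<close>)
  moreover have "(A - C) \<union> (A \<inter> C) = A" by auto
  moreover have "cost K ((C - A) \<union> (A \<inter> C)) = cost K (C - A) + cost K (A \<inter> C)"
    by (rule cost_Un) (use K AC in \<open>auto intro: negligible_subset[of "{}"]\<close>)
  moreover have "(C - A) \<union> (A \<inter> C) = C" by auto
  ultimately have "cost K A - cost K C = cost K (A - C) - cost K (C - A)"
    by simp
  moreover have "\<bar>cost K (A - C)\<bar> \<le> c * B * \<mu> (A - C)" "\<bar>cost K (C - A)\<bar> \<le> c * B * \<mu> (C - A)"
    using cost_bound[OF K AC(1)] cost_bound[OF K AC(2)] c regionsD(2)[OF A] regionsD(2)[OF C] by blast+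
  moreover have "\<mu> ((A \<union> C) - (A \<inter> C)) = \<mu> (A - C) + \<mu> (C - A)"
  proof -
    have "(A \<union> C) - (A \<inter> C) = (A - C) \<union> (C - A)" by auto
    moreover have "\<mu> ((A - C) \<union> (C - A)) = \<mu> (A - C) + \<mu> (C - A)"
      using AC regionsD by (intro measure_Un_AE) auto
    ultimately show ?thesis by simp
  qed
  ultimately show ?thesis
    by (simp add: distrib_left)
qed

text \<open>The integrand \<open>h q * \<phi> q\<close> may come arbitrarily close to zero, but its
  sublevel sets \<open>E n\<close> shrink to a null set. Once \<open>E n\<close> has area below
  \<open>\<delta> / 2\<close>, Chebyshev's inequality with threshold \<open>1 / Suc n\<close> bounds
  the part of \<open>S\<close> outside it by \<open>\<delta> / 2\<close>.\<close>

lemma small_measure: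
  assumes h: "continuous_on UNIV h" and h0: "\<And>q. q \<in> Q \<Longrightarrow> h q \<ge> 0"
    and neg: "negligible {q \<in> Q. h q = 0}" and "\<delta> > 0"
  shows "\<exists>\<eta>>0. \<forall>S\<in>regions. cost h S \<le> \<eta> \<longrightarrow> \<mu> S \<le> \<delta>"
proof -
  define E where "E n = {q \<in> Q. h q * \<phi> q \<le> 1 / Suc n}" for n
  have meas: "(\<lambda>q. h q * \<phi> q) \<in> borel_measurable (lebesgue_on Q)"
  proof -
    have "h \<in> borel_measurable lebesgue"
      by (rule measurable_completion) (simp add: borel_measurable_continuous_onI h)
    then have "h \<in> borel_measurable (lebesgue_on Q)"
      by (rule measurable_restrict_space1)
    then show ?thesis
      using \<phi>_meas by measurable
  qed
  have E_regions: "E n \<in> regions" for n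
  proof -
    have "{q \<in> space (lebesgue_on Q). h q * \<phi> q \<le> 1 / Suc n} \<in> sets (lebesgue_on Q)"
      using meas by measurable
    then show ?thesis
      using Q_sets by (auto simp: E_def regions_def space_restrict_space sets_restrict_space_iff)
  qed
  have "(\<lambda>n. \<mu> (E n)) \<longlonglongrightarrow> \<mu> (\<Inter>n. E n)"
  proof (rule Lim_measure_decseq)
    show "range E \<subseteq> sets lebesgue"
      using regionsD(1)[OF E_regions] by auto
    show "decseq E"
    proof (intro decseq_SucI subsetI)
      fix n q assume "q \<in> E (Suc n)"
      moreover have "1 / real (Suc (Suc n)) \<le> 1 / real (Suc n)"
        by (simp add: frac_le)
      ultimately show "q \<in> E n"
        unfolding E_def by force
    qed
    show "emeasure lebesgue (E n) \<noteq> \<infinity>" for n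
      unfolding infinity_ennreal_def by (rule fmeasurableD2[OF regionsD(3)[OF E_regions]])
  qed
  moreover have "(\<Inter>n. E n) \<subseteq> {q \<in> Q. h q = 0}"
  proof
    fix q assume q: "q \<in> (\<Inter>n. E n)"
    then have "q \<in> Q" by (auto simp: E_def)
    have "h q * \<phi> q \<le> 0"
    proof (rule field_le_epsilon)
      fix e :: real assume "e > 0"
      then obtain n where "1 / real (Suc n) < e"
        using nat_approx_posE by blast
      then show "h q * \<phi> q \<le> 0 + e"
        using q unfolding E_def by (metis (no_types, lifting) INT_D UNIV_I add_0 less_eq_real_def mem_Collect_eq order_trans)
    qed
    then show "q \<in> {q \<in> Q. h q = 0}"
      using \<phi>_pos[OF \<open>q \<in> Q\<close>] h0[OF \<open>q \<in> Q\<close>] \<open>q \<in> Q\<close>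
      by (auto simp: mult_le_0_iff)
  qed
  then have "\<mu> (\<Inter>n. E n) = 0"
    using neg negligible_subset negligible_imp_measure0 by blast
  ultimately have "(\<lambda>n. \<mu> (E n)) \<longlonglongrightarrow> 0"
    by simp
  then have "\<forall>\<^sub>F n in sequentially. \<mu> (E n) < \<delta> / 2"
    using \<open>\<delta> > 0\<close> order_tendstoD(2)[of _ 0 sequentially "\<delta> / 2"] by auto
  then obtain n where n: "\<mu> (E n) < \<delta> / 2"
    unfolding eventually_sequentially by auto
  show ?thesis
  proof (intro exI conjI ballI impI)
    show "\<delta> / 2 / Suc n > 0"
      using \<open>\<delta> > 0\<close> by simp
    fix S assume S: "S \<in> regions" and le: "cost h S \<le> \<delta> / 2 / Suc n"
    have SE: "S - E n \<in> regions"
      using S E_regions regions_ops by blast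
    have "(LINT q:S - E n|lebesgue. 1 / Suc n) \<le> cost h (S - E n)"
      unfolding cost_def
    proof (rule set_integral_mono)
      show "set_integrable lebesgue (S - E n) (\<lambda>q. 1 / real (Suc n))"
        using regionsD(3)[OF SE] by (simp add: set_integrable_def lmeasurable_iff_integrable)
      show "1 / real (Suc n) \<le> h q * \<phi> q" if "q \<in> S - E n" for q
        using that regionsD(2)[OF S] by (auto simp: E_def)
    qed (use integrable_cost[OF h SE] in auto)
    also have "\<dots> \<le> cost h S"
      using h S SE h0 regionsD(2)[OF S] by (intro cost_subset) auto
    finally have "\<mu> (S - E n) / Suc n \<le> \<delta> / 2 / Suc n"
      using le by (simp add: set_lebesgue_integral_def)
    then have "\<mu> (S - E n) \<le> \<delta> / 2"
      unfolding divide_le_cancel by auto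
    moreover have "\<mu> S \<le> \<mu> (E n \<union> (S - E n))"
      using regionsD(3)[OF S] regionsD(3)[OF SE] regionsD(3)[OF E_regions]
      by (intro measure_mono_fmeasurable) (auto intro: fmeasurable.Un)
    moreover have "\<mu> (E n \<union> (S - E n)) \<le> \<mu> (E n) + \<mu> (S - E n)"
      using regionsD(1)[OF SE] regionsD(1)[OF E_regions] by (intro measure_Un_le) auto
    ultimately show "\<mu> S \<le> \<delta>"
      using n by simp
  qed
qed

lemma continuous_section:
  assumes "continuous_on UNIV (\<lambda>(a, b, q). K a b q :: real)"
  shows "continuous_on UNIV (K (a :: real^2) (b :: real^2) :: real^2 \<Rightarrow> real)"
proof -
  have "continuous_on UNIV (\<lambda>q. (a, b, q))"
    by (intro continuous_intros)
  then show ?thesis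
    using continuous_on_compose2[OF assms, of UNIV "\<lambda>q. (a, b, q)"] by simp
qed

lemma bounded_section:
  assumes "continuous_on UNIV (\<lambda>(a, b, q). K (a :: real^2) (b :: real^2) (q :: real^2) :: real)"
  obtains c where "c > 0" "\<And>a b q. a \<in> Q \<Longrightarrow> b \<in> Q \<Longrightarrow> q \<in> Q \<Longrightarrow> \<bar>K a b q\<bar> \<le> c"
proof -
  have "bounded ((\<lambda>(a, b, q). K a b q) ` (Q \<times> Q \<times> Q))"
    by (intro compact_imp_bounded compact_continuous_image compact_Times compact_Q)
      (rule continuous_on_subset[OF assms], simp)
  then obtain c where "c > 0" "\<forall>x\<in>Q \<times> Q \<times> Q. norm ((\<lambda>(a, b, q). K a b q) x) \<le> c"
    unfolding bounded_pos by blast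
  then show ?thesis
    using that by force
qed

text \<open>Uniform over the regions: the kernel is uniformly continuous on the compact set
  \<open>Q \<times> Q \<times> Q\<close> and is integrated against a bounded density, while a change
  of region is paid for by the symmetric difference.\<close>

lemma cost_close:
  assumes K: "continuous_on UNIV (\<lambda>(a, b, q). K (a :: real^2) (b :: real^2) (q :: real^2) :: real)"
    and "e > 0"
  shows "\<exists>d>0. \<forall>a\<in>Q. \<forall>a'\<in>Q. \<forall>b\<in>Q. \<forall>b'\<in>Q. \<forall>A\<in>regions. \<forall>A'\<in>regions.
    norm (a - a') \<le> d \<longrightarrow> norm (b - b') \<le> d \<longrightarrow> \<mu> ((A \<union> A') - (A \<inter> A')) \<le> d \<longrightarrow>
    \<bar>cost (K a b) A - cost (K a' b') A'\<bar> \<le> e"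
proof -
  obtain c where c: "c > 0" "\<And>a b q. a \<in> Q \<Longrightarrow> b \<in> Q \<Longrightarrow> q \<in> Q \<Longrightarrow> \<bar>K a b q\<bar> \<le> c"
    using bounded_section[OF K] by blast
  \<comment> \<open>A change of the kernel by \<open>e'\<close> changes the cost by at most
    \<open>e' * B * \<mu> Q \<le> e / 2\<close>; the added 1 keeps the denominator positive.\<close>
  define e' where "e' = e / (2 * B * (\<mu> Q + 1))"
  have "e' > 0"
    using \<open>e > 0\<close> B_pos by (simp add: e'_def add_nonneg_pos)
  have "uniformly_continuous_on (Q \<times> Q \<times> Q) (\<lambda>(a, b, q). K a b q)"
    using K compact_Q by (intro compact_uniformly_continuous compact_Times)
      (auto intro: continuous_on_subset)
  then obtain d where d: "d > 0" "\<And>x y. x \<in> Q \<times> Q \<times> Q \<Longrightarrow> y \<in> Q \<times> Q \<times> Q \<Longrightarrow> dist y x < d \<Longrightarrow>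
      dist ((\<lambda>(a, b, q). K a b q) y) ((\<lambda>(a, b, q). K a b q) x) < e'"
    unfolding uniformly_continuous_on_def using \<open>e' > 0\<close> by metis
  have dK: "\<bar>K a b q - K a' b' q\<bar> \<le> e'"
    if "a \<in> Q" "a' \<in> Q" "b \<in> Q" "b' \<in> Q" "q \<in> Q" "norm (a - a') \<le> d / 3" "norm (b - b') \<le> d / 3"
    for a a' b b' q
  proof -
    have "dist (a, b, q) (a', b', q) \<le> norm (a - a') + norm (b - b')"
      by (simp add: dist_norm norm_Pair sqrt_sum_squares_le_sum)
    then have "dist (a, b, q) (a', b', q) < d"
      using that \<open>d > 0\<close> by linarith
    then show ?thesis
      using d(2)[of "(a', b', q)" "(a, b, q)"] that by (auto simp: dist_real_def)
  qed
  show ?thesis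
  proof (intro exI conjI ballI impI)
    \<comment> \<open>Two sites moving by \<open>d / 3\<close> each stay below the modulus
      \<open>d\<close>; the second entry limits the effect of changing the region to
      \<open>e / 2\<close>, as the kernel is bounded by \<open>c\<close>.\<close>
    show "min (d / 3) (e / (2 * c * B)) > 0"
      using \<open>d > 0\<close> \<open>e > 0\<close> c B_pos by simp
    fix a a' b b' A A'
    assume *: "a \<in> Q" "a' \<in> Q" "b \<in> Q" "b' \<in> Q" and A: "A \<in> regions" "A' \<in> regions"
      and "norm (a - a') \<le> min (d / 3) (e / (2 * c * B))" "norm (b - b') \<le> min (d / 3) (e / (2 * c * B))"
      and sd: "\<mu> ((A \<union> A') - (A \<inter> A')) \<le> min (d / 3) (e / (2 * c * B))"
    have "\<bar>cost (K a b) A - cost (K a b) A'\<bar> \<le> c * B * \<mu> ((A \<union> A') - (A \<inter> A'))"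
      using cost_symdiff_le[OF continuous_section[OF K] A] c * by blast
    also have "\<dots> \<le> c * B * (e / (2 * c * B))"
      using sd c B_pos by (intro mult_left_mono) auto
    also have "\<dots> = e / 2"
      using c B_pos by (simp add: field_simps)
    finally have 1: "\<bar>cost (K a b) A - cost (K a b) A'\<bar> \<le> e / 2" .
    have "cost (\<lambda>q. K a b q - K a' b' q) A' = cost (K a b) A' - cost (K a' b') A'"
      using A by (intro cost_diff continuous_section[OF K])
    moreover have "\<bar>cost (\<lambda>q. K a b q - K a' b' q) A'\<bar> \<le> e' * B * \<mu> A'"
    proof (rule cost_bound)
      show "continuous_on UNIV (\<lambda>q. K a b q - K a' b' q)"
        by (intro continuous_intros continuous_section[OF K])
      fix q assume "q \<in> A'"
      then show "\<bar>K a b q - K a' b' q\<bar> \<le> e'"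
        using * regionsD(2)[OF A(2)] \<open>norm (a - a') \<le> _\<close> \<open>norm (b - b') \<le> _\<close>
        by (intro dK) auto
    qed (rule A)
    moreover have "e' * B * \<mu> A' \<le> e' * B * (\<mu> Q + 1)"
    proof -
      have "\<mu> A' \<le> \<mu> Q"
        using regionsD[OF A(2)] Q_lmeasurable by (intro measure_mono_fmeasurable) auto
      then show ?thesis
        using \<open>e' > 0\<close> B_pos by (intro mult_left_mono) auto
    qed
    moreover have "e' * B * (\<mu> Q + 1) = e / 2"
      using B_pos measure_nonneg[of lebesgue Q] by (simp add: e'_def field_simps add_nonneg_eq_0_iff)
    ultimately show "\<bar>cost (K a b) A - cost (K a' b') A'\<bar> \<le> e"
      using 1 by linarith
  qed
qed

text \<open>In a sequence of counterexamples only the sites need to converge; the regions stay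
  arbitrary. At the distinct limit sites \<open>small_measure\<close> applies to all regions at
  once, and \<open>cost_close\<close> transports the small cost of \<open>S (r n)\<close> from
  nearby sites to the limits.\<close>

lemma small_measure_uniform:
  assumes K: "continuous_on UNIV (\<lambda>(a, b, q). K (a :: real^2) (b :: real^2) (q :: real^2) :: real)"
    and K0: "\<And>a b q. K a b q \<ge> 0" and neg: "\<And>a b. a \<noteq> b \<Longrightarrow> negligible {q. K a b q = 0}"
    and "\<epsilon> > 0" "\<delta> > 0"
  shows "\<exists>\<eta>>0. \<forall>a\<in>Q. \<forall>b\<in>Q. \<forall>S\<in>regions.
    norm (a - b) \<ge> \<epsilon> \<longrightarrow> cost (K a b) S \<le> \<eta> \<longrightarrow> \<mu> S \<le> \<delta>"
proof (rule ccontr)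
  assume neg_concl: "\<not> ?thesis"
  have "\<exists>a b S. a \<in> Q \<and> b \<in> Q \<and> S \<in> regions \<and> norm (a - b) \<ge> \<epsilon> \<and> cost (K a b) S \<le> 1 / Suc n \<and>
      \<not> \<mu> S \<le> \<delta>" for n
  proof -
    have "1 / real (Suc n) > 0"
      by simp
    then have "\<not> (\<forall>a\<in>Q. \<forall>b\<in>Q. \<forall>S\<in>regions.
        norm (a - b) \<ge> \<epsilon> \<longrightarrow> cost (K a b) S \<le> 1 / Suc n \<longrightarrow> \<mu> S \<le> \<delta>)"
      using neg_concl by blast
    then show ?thesis
      by blast
  qed
  then obtain a b S where abS: "\<And>n. a n \<in> Q" "\<And>n. b n \<in> Q" "\<And>n. S n \<in> regions"
    "\<And>n. norm (a n - b n) \<ge> \<epsilon>" "\<And>n. cost (K (a n) (b n)) (S n) \<le> 1 / Suc n" "\<And>n. \<not> \<mu> (S n) \<le> \<delta>"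
    by metis
  have "seq_compact (Q \<times> Q)"
    using compact_Q by (simp add: compact_Times compact_imp_seq_compact)
  then obtain l r where l: "l \<in> Q \<times> Q" and r: "strict_mono r" and lim: "((\<lambda>n. (a n, b n)) \<circ> r) \<longlonglongrightarrow> l"
    using abS(1,2) by (elim seq_compactE[where f = "\<lambda>n. (a n, b n)"]) auto
  obtain a0 b0 where l_eq: "l = (a0, b0)" by fastforce
  have lima: "(\<lambda>n. a (r n)) \<longlonglongrightarrow> a0" and limb: "(\<lambda>n. b (r n)) \<longlonglongrightarrow> b0"
    using tendsto_fst[OF lim] tendsto_snd[OF lim] by (auto simp: l_eq comp_def)
  have "(\<lambda>n. norm (a (r n) - b (r n))) \<longlonglongrightarrow> norm (a0 - b0)"
    by (intro tendsto_intros lima limb)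
  then have "norm (a0 - b0) \<ge> \<epsilon>"
    by (rule LIMSEQ_le_const) (use abS(4) in auto)
  then have "a0 \<noteq> b0"
    using \<open>\<epsilon> > 0\<close> by auto
  have "negligible {q \<in> Q. K a0 b0 q = 0}"
    using neg[OF \<open>a0 \<noteq> b0\<close>] by (rule negligible_subset) auto
  then obtain \<eta> where \<eta>: "\<eta> > 0" "\<And>S. S \<in> regions \<Longrightarrow> cost (K a0 b0) S \<le> \<eta> \<Longrightarrow> \<mu> S \<le> \<delta>"
    using small_measure[OF continuous_section[OF K] K0 _ \<open>\<delta> > 0\<close>] by blast
  obtain d where d: "d > 0" "\<And>a a' b b' A. a \<in> Q \<Longrightarrow> a' \<in> Q \<Longrightarrow> b \<in> Q \<Longrightarrow> b' \<in> Q \<Longrightarrow> A \<in> regions \<Longrightarrow>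
      norm (a - a') \<le> d \<Longrightarrow> norm (b - b') \<le> d \<Longrightarrow> \<bar>cost (K a b) A - cost (K a' b') A\<bar> \<le> \<eta> / 2"
  proof -
    obtain d where "d > 0" and d: "\<forall>a\<in>Q. \<forall>a'\<in>Q. \<forall>b\<in>Q. \<forall>b'\<in>Q. \<forall>A\<in>regions. \<forall>A'\<in>regions.
        norm (a - a') \<le> d \<longrightarrow> norm (b - b') \<le> d \<longrightarrow> \<mu> ((A \<union> A') - (A \<inter> A')) \<le> d \<longrightarrow>
        \<bar>cost (K a b) A - cost (K a' b') A'\<bar> \<le> \<eta> / 2"
      using cost_close[OF K half_gt_zero[OF \<open>\<eta> > 0\<close>]] by (elim exE conjE) (rule that)
    show ?thesis
    proof (rule that[OF \<open>d > 0\<close>])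
      fix a a' b b' A
      assume "a \<in> Q" "a' \<in> Q" "b \<in> Q" "b' \<in> Q" "A \<in> regions" "norm (a - a') \<le> d" "norm (b - b') \<le> d"
      then show "\<bar>cost (K a b) A - cost (K a' b') A\<bar> \<le> \<eta> / 2"
        using d[rule_format, of a a' b b' A A] \<open>d > 0\<close> by simp
    qed
  qed
  have ev1: "\<forall>\<^sub>F n in sequentially. norm (a0 - a (r n)) < d" "\<forall>\<^sub>F n in sequentially. norm (b0 - b (r n)) < d"
    using tendstoD[OF lima \<open>d > 0\<close>] tendstoD[OF limb \<open>d > 0\<close>] by (simp_all add: dist_norm norm_minus_commute)
  have "(\<lambda>n. 1 / real (Suc (r n))) \<longlonglongrightarrow> 0"
    using LIMSEQ_subseq_LIMSEQ[OF LIMSEQ_inverse_real_of_nat r] by (simp add: comp_def divide_inverse)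
  then have ev2: "\<forall>\<^sub>F n in sequentially. 1 / real (Suc (r n)) < \<eta> / 2"
    by (rule order_tendstoD(2)) (use \<open>\<eta> > 0\<close> in simp)
  obtain n where n: "norm (a0 - a (r n)) < d" "norm (b0 - b (r n)) < d" "1 / real (Suc (r n)) < \<eta> / 2"
    using eventually_happens[OF eventually_conj[OF ev1(1) eventually_conj[OF ev1(2) ev2]]] by auto
  have "\<bar>cost (K a0 b0) (S (r n)) - cost (K (a (r n)) (b (r n))) (S (r n))\<bar> \<le> \<eta> / 2"
    by (rule d(2)) (use n(1,2) abS(1-3) l l_eq in auto)
  then have "cost (K a0 b0) (S (r n)) \<le> \<eta>"
    using n(3) abS(5)[of "r n"] by linarith
  then show False
    using \<eta>(2) abS(3,6) by blast
qed

section \<open>Costs of single points, compared between two sites and their midpoint\<close>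

definition pcost :: "real^2 \<Rightarrow> real^2 \<Rightarrow> real" where
  "pcost p q = f (norm (p - q))"

lemma H1_pcost: "H1 \<phi> f p A = cost (pcost p) A"
  by (simp add: H1_def cost_def pcost_def)

lemma continuous_pcost [continuous_intros]:
  assumes "continuous_on S g" "continuous_on S h"
  shows "continuous_on S (\<lambda>x. pcost (g x) (h x))"
  unfolding pcost_def
  by (rule continuous_on_compose2[OF f_cont]) (auto intro!: continuous_intros assms)

lemma continuous_pcost1: "continuous_on UNIV (pcost p)"
  using continuous_pcost[OF continuous_on_const continuous_on_id] by simp

text \<open>Strict monotonicity of \<open>f\<close> turns comparisons of cost into comparisons of
  distance, so half-planes are the sets where one site is no dearer than the other.\<close>

lemma pcost_less_iff: "pcost a q < pcost b q \<longleftrightarrow> norm (a - q) < norm (b - q)"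
  using strict_mono_on_less[OF f_strict] by (simp add: pcost_def)

lemma pcost_le_iff: "pcost a q \<le> pcost b q \<longleftrightarrow> norm (a - q) \<le> norm (b - q)"
  using pcost_less_iff[of b q a] by (metis not_less)

lemma pcost_eq_iff: "pcost a q = pcost b q \<longleftrightarrow> norm (a - q) = norm (b - q)"
  by (simp add: order_eq_iff pcost_le_iff)

definition gap :: "real^2 \<Rightarrow> real^2 \<Rightarrow> real^2 \<Rightarrow> real" where
  "gap a b q = \<bar>pcost a q - pcost b q\<bar>"

lemma continuous_gap: "continuous_on UNIV (\<lambda>(a, b, q). gap a b q)"
  unfolding gap_def case_prod_beta by (intro continuous_intros)

lemma small_measure_gap:
  assumes "\<epsilon> > 0" "\<delta> > 0"
  shows "\<exists>\<eta>>0. \<forall>a\<in>Q. \<forall>b\<in>Q. \<forall>S\<in>regions.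
    norm (a - b) \<ge> \<epsilon> \<longrightarrow> cost (gap a b) S \<le> \<eta> \<longrightarrow> \<mu> S \<le> \<delta>"
proof (rule small_measure_uniform[OF continuous_gap])
  fix a b :: "real^2" assume "a \<noteq> b"
  then show "negligible {q. gap a b q = 0}"
    using negligible_bisector[of a b] by (simp add: gap_def pcost_eq_iff)
qed (use assms in \<open>auto simp: gap_def\<close>)

text \<open>The defect in midpoint convexity of the cost as a function of the site. If
  \<open>a\<close> and \<open>b\<close> both nearly minimize the cost of a region, its integral over
  that region is small.\<close>

definition midgap :: "real^2 \<Rightarrow> real^2 \<Rightarrow> real^2 \<Rightarrow> real" where
  "midgap a b q = (pcost a q + pcost b q) / 2 - pcost (midpoint a b) q"

lemma continuous_midgap: "continuous_on UNIV (\<lambda>(a, b, q). midgap a b q)"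
  unfolding midgap_def case_prod_beta midpoint_def by (intro continuous_intros) auto

lemma norm_midpoint_diff: "norm (midpoint a b - q) = norm ((a - q) + (b - q)) / 2"
  for a b q :: "real^2"
proof -
  have "midpoint a b - q = (1/2) *\<^sub>R ((a - q) + (b - q))"
    by (simp add: vec_eq_iff midpoint_def field_simps)
  then show ?thesis by simp
qed

text \<open>Convexity of \<open>f\<close> gives the bound at the average distance, monotonicity the
  passage from there to the distance from the midpoint. Strictness is drawn from the second step
  alone, through the equality case of the triangle inequality, so \<open>f\<close> may be
  affine.\<close>

lemma pcost_midpoint:
  shows "f ((norm (a - q) + norm (b - q)) / 2) \<le> (pcost a q + pcost b q) / 2"
    and "pcost (midpoint a b) q \<le> f ((norm (a - q) + norm (b - q)) / 2)"
    and "norm (a - q) + norm (b - q) \<noteq> norm ((a - q) + (b - q)) \<Longrightarrow>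
      pcost (midpoint a b) q < f ((norm (a - q) + norm (b - q)) / 2)"
proof -
  show "f ((norm (a - q) + norm (b - q)) / 2) \<le> (pcost a q + pcost b q) / 2"
    using convex_onD[OF f_convex, of "1/2" "norm (a - q)" "norm (b - q)"]
    by (simp add: pcost_def add_divide_distrib)
  have le: "norm ((a - q) + (b - q)) \<le> norm (a - q) + norm (b - q)"
    by (rule norm_triangle_ineq)
  show "pcost (midpoint a b) q \<le> f ((norm (a - q) + norm (b - q)) / 2)"
    unfolding pcost_def norm_midpoint_diff
    using strict_mono_on_leD[OF f_strict] le by simp
  show "pcost (midpoint a b) q < f ((norm (a - q) + norm (b - q)) / 2)"
    if "norm (a - q) + norm (b - q) \<noteq> norm ((a - q) + (b - q))"
    unfolding pcost_def norm_midpoint_diff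
    using strict_mono_onD[OF f_strict] le that by simp
qed

lemma small_measure_midgap:
  assumes "\<epsilon> > 0" "\<delta> > 0"
  shows "\<exists>\<eta>>0. \<forall>a\<in>Q. \<forall>b\<in>Q. \<forall>S\<in>regions.
    norm (a - b) \<ge> \<epsilon> \<longrightarrow> cost (midgap a b) S \<le> \<eta> \<longrightarrow> \<mu> S \<le> \<delta>"
proof (rule small_measure_uniform[OF continuous_midgap])
  show "0 \<le> midgap a b q" for a b q
    using pcost_midpoint(1)[of a q b] pcost_midpoint(2)[of a b q] by (simp add: midgap_def)
  fix a b :: "real^2" assume "a \<noteq> b"
  have "{q. midgap a b q = 0} \<subseteq> {q. norm (a - q) + norm (b - q) = norm ((a - q) + (b - q))}"
  proof (intro subsetI CollectI)
    fix q assume "q \<in> {q. midgap a b q = 0}"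
    then show "norm (a - q) + norm (b - q) = norm ((a - q) + (b - q))"
      using pcost_midpoint(1)[of a q b] pcost_midpoint(3)[of a q b] by (auto simp: midgap_def)
  qed
  then show "negligible {q. midgap a b q = 0}"
    using negligible_norm_midpoint_eq[OF \<open>a \<noteq> b\<close>] negligible_subset by blast
qed (use assms in auto)

text \<open>A relation and not a function: existence and uniqueness of the minimizer are established
  for it first, and only then does the description operator in \<open>Cd\<close> carry
  information.\<close>

definition centroid :: "real^2 \<Rightarrow> (real^2) set \<Rightarrow> bool" where
  "centroid a A \<longleftrightarrow> a \<in> Q \<and> (\<forall>p\<in>Q. cost (pcost a) A \<le> cost (pcost p) A)"

text \<open>
  When \<open>A\<close> and \<open>C\<close> nearly coincide, \<open>a\<close> and \<open>c\<close> both nearly minimize the cost over \<open>A\<close>; were they far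
  apart, strict convexity off the line through them would make their midpoint cheaper than the minimum.
  The case \<open>C = A\<close> is uniqueness.
\<close>

lemma centroid_close:
  assumes "\<epsilon> > 0" "\<delta> > 0"
  shows "\<exists>\<eta>>0. \<forall>A\<in>regions. \<forall>C\<in>regions. \<forall>a c. centroid a A \<longrightarrow> centroid c C \<longrightarrow> \<mu> A \<ge> \<epsilon> \<longrightarrow>
    \<mu> ((A \<union> C) - (A \<inter> C)) \<le> \<eta> \<longrightarrow> norm (a - c) < \<delta>"
proof -
  \<comment> \<open>The bound \<open>\<epsilon> / 2\<close> is chosen to contradict
    \<open>\<mu> A \<ge> \<epsilon>\<close>.\<close>
  obtain \<eta> where \<eta>: "\<eta> > 0" "\<forall>a\<in>Q. \<forall>b\<in>Q. \<forall>S\<in>regions.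
    norm (a - b) \<ge> \<delta> \<longrightarrow> cost (midgap a b) S \<le> \<eta> \<longrightarrow> \<mu> S \<le> \<epsilon> / 2"
    using small_measure_midgap[OF \<open>\<delta> > 0\<close> half_gt_zero[OF \<open>\<epsilon> > 0\<close>]]
    by (elim exE conjE) (rule that)
  \<comment> \<open>A kernel constant in the second site, to fit the lemmas about two sites.\<close>
  have K: "continuous_on UNIV (\<lambda>(a, b :: real^2, q). pcost a q)"
    unfolding case_prod_beta by (intro continuous_intros)
  obtain c where c: "c > 0" "\<And>a q. a \<in> Q \<Longrightarrow> q \<in> Q \<Longrightarrow> \<bar>pcost a q\<bar> \<le> c"
    by (rule bounded_section[OF K]) (rule that)
  show ?thesis
  proof (intro exI conjI ballI impI allI)
    show "\<eta> / (c * B) > 0"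
      using \<eta> c B_pos by simp
    fix A C a b
    assume A: "A \<in> regions" and C: "C \<in> regions" and a: "centroid a A" and b: "centroid b C"
      and "\<mu> A \<ge> \<epsilon>" and sd: "\<mu> ((A \<union> C) - (A \<inter> C)) \<le> \<eta> / (c * B)"
    show "norm (a - b) < \<delta>"
    proof (rule ccontr)
      assume "\<not> norm (a - b) < \<delta>"
      have "a \<in> Q" "b \<in> Q"
        using a b by (auto simp: centroid_def)
      then have m: "midpoint a b \<in> Q"
        using convex_Q by (meson closed_segment_subset midpoint_in_closed_segment subsetD)
      have near: "\<bar>cost (pcost p) A - cost (pcost p) C\<bar> \<le> \<eta>" if "p \<in> Q" for p
      proof -
        have "\<bar>cost (pcost p) A - cost (pcost p) C\<bar> \<le> c * B * \<mu> ((A \<union> C) - (A \<inter> C))"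
          using cost_symdiff_le[OF continuous_pcost1 A C] c that by blast
        also have "\<dots> \<le> c * B * (\<eta> / (c * B))"
          using sd c B_pos by (intro mult_left_mono) auto
        also have "\<dots> = \<eta>"
          using c B_pos by simp
        finally show ?thesis .
      qed
      have "cost (midgap a b) A = cost (\<lambda>q. (1/2) * (pcost a q + pcost b q)) A - cost (pcost (midpoint a b)) A"
        using cost_diff[of "\<lambda>q. (1/2) * (pcost a q + pcost b q)" "pcost (midpoint a b)" A] A continuous_pcost1
        by (simp add: midgap_def[abs_def] continuous_intros)
      also have "cost (\<lambda>q. (1/2) * (pcost a q + pcost b q)) A = (cost (pcost a) A + cost (pcost b) A) / 2"
        using cost_cmult[of "1/2" "\<lambda>q. pcost a q + pcost b q"] cost_add[OF continuous_pcost1 continuous_pcost1 A]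
        by simp
      finally have "cost (midgap a b) A =
          (cost (pcost a) A + cost (pcost b) A) / 2 - cost (pcost (midpoint a b)) A" .
      moreover have "cost (pcost a) A \<le> cost (pcost (midpoint a b)) A"
        using a m by (simp add: centroid_def)
      moreover have "cost (pcost b) C \<le> cost (pcost a) C"
        using b \<open>a \<in> Q\<close> by (simp add: centroid_def)
      \<comment> \<open>Passing from \<open>A\<close> to \<open>C\<close> and back loses
        \<open>\<eta>\<close> twice, so \<open>b\<close> is within \<open>2 * \<eta>\<close> of the
        minimum over \<open>A\<close>; the averaging in \<open>midgap\<close> halves this
        loss.\<close>
      ultimately have "cost (midgap a b) A \<le> \<eta>"
        using near[OF \<open>a \<in> Q\<close>, THEN abs_le_D2] near[OF \<open>b \<in> Q\<close>, THEN abs_le_D1] by argo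
      then have "\<mu> A \<le> \<epsilon> / 2"
        using \<eta>(2)[rule_format, OF \<open>a \<in> Q\<close> \<open>b \<in> Q\<close> A] \<open>\<not> norm (a - b) < \<delta>\<close> by simp
      then show False
        using \<open>\<mu> A \<ge> \<epsilon>\<close> \<open>\<epsilon> > 0\<close> by simp
    qed
  qed
qed

lemma centroid_unique:
  assumes "A \<in> regions" "\<mu> A > 0" "centroid a A" "centroid b A"
  shows "a = b"
proof (rule ccontr)
  assume "a \<noteq> b"
  then have pos: "norm (a - b) > 0"
    by simp
  obtain \<eta> where "\<eta> > 0" and *: "\<forall>A'\<in>regions. \<forall>C\<in>regions. \<forall>a' c. centroid a' A' \<longrightarrow> centroid c C \<longrightarrow>
    \<mu> A' \<ge> \<mu> A \<longrightarrow> \<mu> ((A' \<union> C) - (A' \<inter> C)) \<le> \<eta> \<longrightarrow> norm (a' - c) < norm (a - b)"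
    using centroid_close[OF assms(2) pos] by (elim exE conjE) (rule that)
  have "norm (a - b) < norm (a - b)"
    using *[rule_format, OF assms(1,1,3,4)] \<open>\<eta> > 0\<close> by simp
  then show False by simp
qed

lemma centroid_exists:
  assumes "A \<in> regions"
  shows "\<exists>a. centroid a A"
proof -
  have K: "continuous_on UNIV (\<lambda>(a, b :: real^2, q). pcost a q)"
    unfolding case_prod_beta by (intro continuous_intros)
  have "continuous_on Q (\<lambda>p. cost (pcost p) A)"
    unfolding continuous_on_iff
  proof (intro ballI allI impI)
    fix p e assume "p \<in> Q" and "(e :: real) > 0"
    then have "e / 2 > 0"
      by simp
    obtain d where d: "d > 0" "\<forall>a\<in>Q. \<forall>a'\<in>Q. \<forall>b\<in>Q. \<forall>b'\<in>Q. \<forall>A\<in>regions. \<forall>A'\<in>regions.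
      norm (a - a') \<le> d \<longrightarrow> norm (b - b') \<le> d \<longrightarrow> \<mu> ((A \<union> A') - (A \<inter> A')) \<le> d \<longrightarrow>
      \<bar>cost (pcost a) A - cost (pcost a') A'\<bar> \<le> e / 2"
      using cost_close[OF K \<open>e / 2 > 0\<close>] by (elim exE conjE) (rule that)
    show "\<exists>d>0. \<forall>x'\<in>Q. dist x' p < d \<longrightarrow> dist (cost (pcost x') A) (cost (pcost p) A) < e"
    proof (intro exI conjI ballI impI)
      fix x assume "x \<in> Q" "dist x p < d"
      then have "\<bar>cost (pcost x) A - cost (pcost p) A\<bar> \<le> e / 2"
        using d(2)[rule_format, of x p p p A A] d(1) \<open>p \<in> Q\<close> assms by (simp add: dist_norm)
      then show "dist (cost (pcost x) A) (cost (pcost p) A) < e"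
        using \<open>e > 0\<close> by (simp add: dist_real_def)
    qed (rule d)
  qed
  moreover have "Q \<noteq> {}"
    using interior_Q interior_subset by fastforce
  ultimately show ?thesis
    using continuous_attains_inf[OF compact_Q] unfolding centroid_def by meson
qed

lemma centroid_Cd:
  assumes "A \<in> regions" "\<mu> A > 0"
  shows "centroid (Cd Q \<phi> f A) A"
proof -
  have eq: "is_arg_min (\<lambda>p. H1 \<phi> f p A) (\<lambda>p. p \<in> Q) = (\<lambda>p. centroid p A)"
    by (auto simp: fun_eq_iff is_arg_min_def centroid_def H1_pcost not_less)
  show ?thesis
    unfolding Cd_def eq using centroid_exists[OF assms(1)] centroid_unique[OF assms]
    by (metis (no_types, lifting) theI)
qed

lemma Cd_in_Q: "A \<in> regions \<Longrightarrow> \<mu> A > 0 \<Longrightarrow> Cd Q \<phi> f A \<in> Q"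
  using centroid_Cd by (simp add: centroid_def)

section \<open>The gossip dynamics\<close>

abbreviation C :: "(real^2) set \<Rightarrow> real^2" where "C A \<equiv> Cd Q \<phi> f A"

text \<open>Integrating the positive part over a whole region gives the saving from reassigning its
  points off the half-plane, but with an integrand continuous in both sites and a domain that does
  not move with them.\<close>

definition gain :: "real^2 \<Rightarrow> real^2 \<Rightarrow> real^2 \<Rightarrow> real" where
  "gain a b q = max 0 (pcost a q - pcost b q)"

definition excess :: "('n::finite \<Rightarrow> (real^2) set) \<Rightarrow> 'n \<Rightarrow> 'n \<Rightarrow> real" where
  "excess v i j = cost (gain (C (v i)) (C (v j))) (v i)"

definition energy :: "('n::finite \<Rightarrow> (real^2) set) \<Rightarrow> real" where
  "energy v = (\<Sum>i\<in>UNIV. cost (pcost (C (v i))) (v i))"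

text \<open>
  Members of a partition have disjoint interiors, but their boundaries may have positive area; only finite
  convexity makes the overlaps negligible.
\<close>

definition regular :: "real \<Rightarrow> ('n::finite \<Rightarrow> (real^2) set) \<Rightarrow> bool" where
  "regular \<epsilon> v \<longleftrightarrow> v \<in> partitions Q \<and> (\<forall>i. \<mu> (v i) \<ge> \<epsilon>) \<and>
    (\<forall>i j. i \<noteq> j \<longrightarrow> norm (C (v i) - C (v j)) \<ge> \<epsilon> \<and> negligible (v i \<inter> v j))"

lemma nondegenerate_regular:
  fixes v :: "nat \<Rightarrow> 'n::finite \<Rightarrow> (real^2) set"
  assumes part: "\<And>t. v t \<in> partitions Q" and nd: "nondegenerate Q \<phi> f v"
  shows "\<exists>\<epsilon>>0. \<forall>t. regular \<epsilon> (v t)"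
proof -
  note nd = nd[unfolded nondegenerate_def]
  obtain e1 where e1: "e1 > 0" "\<forall>t i j. i \<noteq> j \<longrightarrow> norm (C (v t i) - C (v t j)) \<ge> e1"
    using nd[THEN conjunct1] by (elim exE conjE) (rule that)
  obtain e2 where e2: "e2 > 0" "\<forall>t i. \<mu> (v t i) > e2"
    using nd[THEN conjunct2, THEN conjunct1] by (elim exE conjE) (rule that)
  have fr: "negligible (frontier (v t i))" for t i
  proof -
    obtain l where "\<forall>t i. \<exists>\<C>. finite \<C> \<and> card \<C> \<le> l \<and> (\<forall>C\<in>\<C>. convex C) \<and> v t i = \<Union>\<C>"
      using nd[THEN conjunct2, THEN conjunct2] by (elim exE) (rule that)
    from this[THEN spec, THEN spec, of t i]
    obtain \<C> where "finite \<C>" "\<forall>C\<in>\<C>. convex C" "v t i = \<Union>\<C>"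
      by (elim exE conjE) (rule that)
    then show ?thesis
      using negligible_frontier_Union_convex[of \<C>] by simp
  qed
  have "regular (min e1 e2) (v t)" for t
    unfolding regular_def
  proof (intro conjI allI impI)
    show "v t \<in> partitions Q" by (rule part)
    show "min e1 e2 \<le> \<mu> (v t i)" for i
      using e2(2)[rule_format, of t i] by simp
    fix i j :: 'n assume "i \<noteq> j"
    then show "min e1 e2 \<le> norm (C (v t i) - C (v t j))"
      using e1(2)[rule_format, of i j t] by simp
    show "negligible (v t i \<inter> v t j)"
      using part[of t] \<open>i \<noteq> j\<close> fr by (intro negligible_Int_of_disjoint_interiors) (auto simp: partitions_def)
  qed
  then show ?thesis
    using e1(1) e2(1) by (intro exI[of _ "min e1 e2"]) auto
qed

lemma regular_region: "regular \<epsilon> v \<Longrightarrow> v i \<in> regions"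
  by (rule regions_closed) (simp_all add: regular_def partitions_def)

lemma regular_centroid:
  assumes "\<epsilon> > 0" "regular \<epsilon> v"
  shows "centroid (C (v i)) (v i)" "C (v i) \<in> Q"
proof -
  have "\<mu> (v i) \<ge> \<epsilon>"
    using assms(2) by (simp add: regular_def)
  then have "\<mu> (v i) > 0"
    using assms(1) by linarith
  then show "centroid (C (v i)) (v i)" "C (v i) \<in> Q"
    using centroid_Cd Cd_in_Q regular_region[OF assms(2)] by auto
qed

lemma continuous_gain: "continuous_on UNIV (\<lambda>(a, b, q). gain a b q)"
  unfolding gain_def case_prod_beta by (intro continuous_intros)

lemma gain_nonneg: "gain a b q \<ge> 0"
  by (simp add: gain_def)

lemma excess_nonneg: "regular \<epsilon> v \<Longrightarrow> excess v i j \<ge> 0"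
  unfolding excess_def using gain_nonneg regular_region by (intro cost_nonneg)

text \<open>Two moduli are composed: nearby regions have nearby centroids, since areas are at least
  \<open>\<epsilon>\<close>, and the cost of \<open>gain\<close> varies uniformly with sites and
  region.\<close>

lemma excess_close:
  assumes "\<epsilon> > 0" "e > 0"
  shows "\<exists>d>0. \<forall>v v' :: 'n::finite \<Rightarrow> (real^2) set. regular \<epsilon> v \<longrightarrow> regular \<epsilon> v' \<longrightarrow>
    (\<forall>k. \<mu> ((v k \<union> v' k) - (v k \<inter> v' k)) \<le> d) \<longrightarrow> (\<forall>i j. \<bar>excess v i j - excess v' i j\<bar> \<le> e)"
proof -
  obtain d where d: "d > 0" "\<forall>a\<in>Q. \<forall>a'\<in>Q. \<forall>b\<in>Q. \<forall>b'\<in>Q. \<forall>A\<in>regions. \<forall>A'\<in>regions.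
    norm (a - a') \<le> d \<longrightarrow> norm (b - b') \<le> d \<longrightarrow> \<mu> ((A \<union> A') - (A \<inter> A')) \<le> d \<longrightarrow>
    \<bar>cost (gain a b) A - cost (gain a' b') A'\<bar> \<le> e"
    using cost_close[OF continuous_gain \<open>e > 0\<close>] by (elim exE conjE) (rule that)
  obtain \<eta> where \<eta>: "\<eta> > 0" "\<forall>A\<in>regions. \<forall>C\<in>regions. \<forall>a c. centroid a A \<longrightarrow> centroid c C \<longrightarrow>
    \<mu> A \<ge> \<epsilon> \<longrightarrow> \<mu> ((A \<union> C) - (A \<inter> C)) \<le> \<eta> \<longrightarrow> norm (a - c) < d"
    using centroid_close[OF \<open>\<epsilon> > 0\<close> \<open>d > 0\<close>] by (elim exE conjE) (rule that)
  show ?thesis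
  proof (intro exI conjI allI impI)
    show "min d \<eta> > 0"
      using d \<eta> by simp
    fix v v' :: "'n \<Rightarrow> (real^2) set" and i j
    assume v: "regular \<epsilon> v" and v': "regular \<epsilon> v'"
      and sd: "\<forall>k. \<mu> ((v k \<union> v' k) - (v k \<inter> v' k)) \<le> min d \<eta>"
    have "norm (C (v k) - C (v' k)) \<le> d" for k
      using \<eta>(2)[rule_format, OF regular_region[OF v] regular_region[OF v'] regular_centroid(1)[OF \<open>\<epsilon> > 0\<close> v]
          regular_centroid(1)[OF \<open>\<epsilon> > 0\<close> v'], of k k] v sd
      by (simp add: regular_def less_imp_le)
    then show "\<bar>excess v i j - excess v' i j\<bar> \<le> e"
      unfolding excess_def using sd
      by (intro d(2)[rule_format] regular_region[OF v] regular_region[OF v'] regular_centroid(2)[OF \<open>\<epsilon> > 0\<close>] v v')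
        auto
  qed
qed

lemma closed_halfplane: "closed (halfplane a b)"
  unfolding halfplane_def by (intro closed_Collect_le continuous_intros)

lemma halfplane_sets: "halfplane a b \<in> sets lebesgue"
  using closed_halfplane by simp

lemma in_halfplane: "q \<in> halfplane a b \<longleftrightarrow> norm (a - q) \<le> norm (b - q)"
  by (simp add: halfplane_def norm_minus_commute)

text \<open>Off \<open>halfplane a b\<close> the site \<open>b\<close> is strictly cheaper, so
  \<open>gain\<close> coincides there with \<open>gap\<close> and the area bound for
  \<open>gap\<close> applies.\<close>

lemma cost_gain_small:
  assumes "\<epsilon> > 0" "\<delta> > 0"
  shows "\<exists>\<eta>>0. \<forall>a\<in>Q. \<forall>b\<in>Q. \<forall>A\<in>regions.
    norm (a - b) \<ge> \<epsilon> \<longrightarrow> cost (gain a b) A \<le> \<eta> \<longrightarrow> \<mu> (A - halfplane a b) \<le> \<delta>"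
proof -
  obtain \<eta> where \<eta>: "\<eta> > 0" "\<forall>a\<in>Q. \<forall>b\<in>Q. \<forall>S\<in>regions.
    norm (a - b) \<ge> \<epsilon> \<longrightarrow> cost (gap a b) S \<le> \<eta> \<longrightarrow> \<mu> S \<le> \<delta>"
    using small_measure_gap[OF assms] by (elim exE conjE) (rule that)
  show ?thesis
  proof (intro exI conjI ballI impI, rule \<eta>(1))
    fix a b A assume ab: "a \<in> Q" "b \<in> Q" and A: "A \<in> regions" and "norm (a - b) \<ge> \<epsilon>"
      and le: "cost (gain a b) A \<le> \<eta>"
    have A': "A - halfplane a b \<in> regions"
      using regions_Int(2)[OF A halfplane_sets] .
    have "cost (gap a b) (A - halfplane a b) = cost (gain a b) (A - halfplane a b)"
      by (rule cost_cong) (use pcost_le_iff in \<open>force simp: gap_def gain_def in_halfplane\<close>)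
    also have "\<dots> \<le> cost (gain a b) A"
      by (rule cost_subset[OF continuous_section[OF continuous_gain] A A'])
        (auto simp: gain_nonneg)
    finally have "cost (gap a b) (A - halfplane a b) \<le> \<eta>"
      using le by simp
    then show "\<mu> (A - halfplane a b) \<le> \<delta>"
      using \<eta>(2)[rule_format, OF ab A'] \<open>norm (a - b) \<ge> \<epsilon>\<close> by simp
  qed
qed

lemma cost_min:
  assumes "A \<in> regions"
  shows "cost (\<lambda>q. min (pcost a q) (pcost b q)) A = cost (pcost a) A - cost (gain a b) A"
proof -
  have "cost (\<lambda>q. pcost a q - gain a b q) A = cost (pcost a) A - cost (gain a b) A"
    using assms by (intro cost_diff continuous_pcost1 continuous_section[OF continuous_gain])
  moreover have "(\<lambda>q. pcost a q - gain a b q) = (\<lambda>q. min (pcost a q) (pcost b q))"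
    by (auto simp: gain_def fun_eq_iff)
  ultimately show ?thesis by simp
qed

lemma gossip_map_eq:
  assumes "C (v i) \<noteq> C (v j)"
  shows "gossip_map Q \<phi> f (i, j) v =
    v(i := (v i \<union> v j) \<inter> halfplane (C (v i)) (C (v j)), j := (v i \<union> v j) \<inter> halfplane (C (v j)) (C (v i)))"
  using assms by (simp add: gossip_map_def Let_def)

text \<open>The new regions are first charged from the old centroids. Each point then pays the
  smaller of its two costs, and integrating this minimum over \<open>v i \<union> v j\<close> gives
  the old cost minus both excesses. Moving to the new centroids can only lower the cost. Additivity
  needs negligible overlaps: the bisector for the new pair, regularity for the old one.\<close>

lemma energy_decrease:
  fixes v :: "'n::finite \<Rightarrow> (real^2) set"
  assumes "\<epsilon> > 0" and v: "regular \<epsilon> v" and "i \<noteq> j" and v': "regular \<epsilon> (gossip_map Q \<phi> f (i, j) v)"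
  shows "energy (gossip_map Q \<phi> f (i, j) v) \<le> energy v - excess v i j - excess v j i"
proof -
  define a b where "a = C (v i)" and "b = C (v j)"
  have "a \<noteq> b"
    using v \<open>i \<noteq> j\<close> \<open>\<epsilon> > 0\<close> unfolding regular_def a_def b_def by fastforce
  define w where "w = gossip_map Q \<phi> f (i, j) v"
  have w: "w = v(i := (v i \<union> v j) \<inter> halfplane a b, j := (v i \<union> v j) \<inter> halfplane b a)"
    using gossip_map_eq \<open>a \<noteq> b\<close> unfolding w_def a_def b_def by blast
  have wi: "w i = (v i \<union> v j) \<inter> halfplane a b" and wj: "w j = (v i \<union> v j) \<inter> halfplane b a"
    using \<open>i \<noteq> j\<close> by (auto simp: w)
  note regions = regular_region[OF v] regular_region[OF v'[folded w_def]]
  define m where "m q = min (pcost a q) (pcost b q)" for q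
  have m: "continuous_on UNIV m"
    unfolding m_def by (intro continuous_intros continuous_pcost1)
  have "cost (pcost (C (w i))) (w i) \<le> cost (pcost a) (w i)"
    using regular_centroid[OF \<open>\<epsilon> > 0\<close>] v v' unfolding centroid_def a_def w_def by blast
  also have "\<dots> = cost m (w i)"
    by (rule cost_cong) (auto simp: m_def wi in_halfplane pcost_le_iff[symmetric])
  finally have 1: "cost (pcost (C (w i))) (w i) \<le> cost m (w i)" .
  have "cost (pcost (C (w j))) (w j) \<le> cost (pcost b) (w j)"
    using regular_centroid[OF \<open>\<epsilon> > 0\<close>] v v' unfolding centroid_def b_def w_def by blast
  also have "\<dots> = cost m (w j)"
    by (rule cost_cong) (auto simp: m_def wj in_halfplane pcost_le_iff[symmetric])
  finally have 2: "cost (pcost (C (w j))) (w j) \<le> cost m (w j)" .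
  have "cost m (w i) + cost m (w j) = cost m (w i \<union> w j)"
  proof (rule cost_Un[symmetric, OF m regions(2) regions(2)])
    have "w i \<inter> w j \<subseteq> {q. norm (a - q) = norm (b - q)}"
      by (auto simp: wi wj in_halfplane)
    then show "negligible (w i \<inter> w j)"
      using negligible_bisector[OF \<open>a \<noteq> b\<close>] negligible_subset by blast
  qed
  also have "w i \<union> w j = v i \<union> v j"
    by (auto simp: wi wj in_halfplane)
  also have "cost m (v i \<union> v j) = cost m (v i) + cost m (v j)"
    using v \<open>i \<noteq> j\<close> by (intro cost_Un m regions) (simp add: regular_def)
  also have "cost m (v i) = cost (pcost (C (v i))) (v i) - excess v i j"
    unfolding m_def excess_def a_def b_def by (intro cost_min regions)
  also have "cost m (v j) = cost (pcost (C (v j))) (v j) - excess v j i"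
    unfolding m_def excess_def a_def b_def min.commute[of "pcost (C (v i)) _"] by (intro cost_min regions)
  finally have 3: "cost m (w i) + cost m (w j) = (cost (pcost (C (v i))) (v i) - excess v i j) +
    (cost (pcost (C (v j))) (v j) - excess v j i)" .
  have "energy w - energy v = (\<Sum>k\<in>UNIV. cost (pcost (C (w k))) (w k) - cost (pcost (C (v k))) (v k))"
    by (simp add: energy_def sum_subtractf)
  also have "\<dots> = (\<Sum>k\<in>{i, j}. cost (pcost (C (w k))) (w k) - cost (pcost (C (v k))) (v k))"
    by (rule sum.mono_neutral_right) (auto simp: w)
  finally have "energy w - energy v = (cost (pcost (C (w i))) (w i) - cost (pcost (C (v i))) (v i)) +
    (cost (pcost (C (w j))) (w j) - cost (pcost (C (v j))) (v j))"
    using \<open>i \<noteq> j\<close> by simp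
  then show ?thesis
    using 1 2 3 unfolding w_def by linarith
qed

lemma gossip_symdiff_le:
  fixes v :: "'n::finite \<Rightarrow> (real^2) set"
  assumes v: "v i \<in> regions" "v j \<in> regions" and "i \<noteq> j" and ne: "C (v i) \<noteq> C (v j)"
  shows "\<mu> ((v k \<union> gossip_map Q \<phi> f (i, j) v k) - (v k \<inter> gossip_map Q \<phi> f (i, j) v k)) \<le>
    \<mu> (v i - halfplane (C (v i)) (C (v j))) + \<mu> (v j - halfplane (C (v j)) (C (v i)))"
proof -
  define a b where "a = C (v i)" and "b = C (v j)"
  define w where "w = gossip_map Q \<phi> f (i, j) v"
  have w: "w = v(i := (v i \<union> v j) \<inter> halfplane a b, j := (v i \<union> v j) \<inter> halfplane b a)"
    using gossip_map_eq[OF ne] unfolding w_def a_def b_def by blast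
  define N where "N = {q. norm (a - q) = norm (b - q)}"
  have N: "negligible N"
    unfolding N_def by (rule negligible_bisector) (use ne in \<open>simp add: a_def b_def\<close>)
  define S T where "S = v i - halfplane a b" and "T = v j - halfplane b a"
  have ST: "S \<in> regions" "T \<in> regions"
    unfolding S_def T_def by (intro regions_Int v halfplane_sets)+
  \<comment> \<open>Away from the bisector a point changes region only if it was on the wrong side;
    points of the two regions on the bisector enter both new regions and are absorbed by
    \<open>N\<close>.\<close>
  have sub: "(v k \<union> w k) - (v k \<inter> w k) \<subseteq> (S \<union> T) \<union> N"
    using \<open>i \<noteq> j\<close> by (auto simp: w S_def T_def N_def in_halfplane)
  show ?thesis
  proof (cases "k = i \<or> k = j")
    case False
    then have "(v k \<union> w k) - (v k \<inter> w k) = {}"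
      by (auto simp: w)
    then show ?thesis
      unfolding w_def by (simp only: measure_empty) simp
  next
    case True
    then have "v k \<in> regions" "w k \<in> regions"
      using v regions_Int(1)[OF regions_ops(1)[OF v] halfplane_sets] by (auto simp: w)
    then have meas: "(v k \<union> w k) - (v k \<inter> w k) \<in> sets lebesgue"
      using regionsD(1) by auto
    have "\<mu> ((v k \<union> w k) - (v k \<inter> w k)) \<le> \<mu> ((S \<union> T) \<union> N)"
      using sub meas ST regionsD(3) N
      by (intro measure_mono_fmeasurable) (auto intro: fmeasurable.Un simp: negligible_iff_measure)
    also have "\<dots> \<le> \<mu> (S \<union> T) + \<mu> N"
      using ST regionsD(1) N by (intro measure_Un_le) (auto simp: negligible_imp_sets)
    also have "\<dots> \<le> \<mu> S + \<mu> T"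
      using measure_Un_le[of S lebesgue T] ST regionsD(1) negligible_imp_measure0[OF N] by simp
    finally show ?thesis
      unfolding S_def T_def w_def a_def b_def .
  qed
qed

section \<open>Asymptotics of the excesses along a single regular evolution\<close>

context
  fixes v :: "nat \<Rightarrow> 'n::finite \<Rightarrow> (real^2) set" and \<sigma> :: "nat \<Rightarrow> 'n \<times> 'n" and \<epsilon> :: real
  assumes pos: "\<epsilon> > 0" and reg: "\<And>t. regular \<epsilon> (v t)"
    and \<sigma>: "\<And>t. \<sigma> t \<in> gossip_pairs"
    and step: "\<And>t. v (Suc t) = gossip_map Q \<phi> f (\<sigma> t) (v t)"
begin

lemma excess_active_tendsto:
  "(\<lambda>t. excess (v t) (fst (\<sigma> t)) (snd (\<sigma> t))) \<longlonglongrightarrow> 0"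
  "(\<lambda>t. excess (v t) (snd (\<sigma> t)) (fst (\<sigma> t))) \<longlonglongrightarrow> 0"
proof -
  have dec: "energy (v (Suc t)) \<le> energy (v t) - excess (v t) (fst (\<sigma> t)) (snd (\<sigma> t)) -
      excess (v t) (snd (\<sigma> t)) (fst (\<sigma> t))" for t
    using energy_decrease[OF pos reg, of "fst (\<sigma> t)" "snd (\<sigma> t)" t] reg[of "Suc t"] \<sigma>[of t] step[of t]
    by (auto simp: gossip_pairs_def)
  have nonneg: "excess (v t) i j \<ge> 0" for t i j
    by (rule excess_nonneg[OF reg])
  have "decseq (\<lambda>t. energy (v t))"
  proof (intro decseq_SucI)
    show "energy (v (Suc t)) \<le> energy (v t)" for t
      using dec[of t] nonneg[of t "fst (\<sigma> t)" "snd (\<sigma> t)"] nonneg[of t "snd (\<sigma> t)" "fst (\<sigma> t)"]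
      by linarith
  qed
  moreover have "energy (v t) \<ge> 0" for t
    unfolding energy_def by (intro sum_nonneg cost_nonneg regular_region[OF reg]) (simp add: pcost_def f_nonneg)
  ultimately obtain L where L: "(\<lambda>t. energy (v t)) \<longlonglongrightarrow> L"
    using decseq_convergent by blast
  have "(\<lambda>t. energy (v t) - energy (v (Suc t))) \<longlonglongrightarrow> L - L"
    by (intro tendsto_diff L LIMSEQ_Suc)
  then have lim: "(\<lambda>t. energy (v t) - energy (v (Suc t))) \<longlonglongrightarrow> 0"
    by simp
  show "(\<lambda>t. excess (v t) (fst (\<sigma> t)) (snd (\<sigma> t))) \<longlonglongrightarrow> 0"
  proof (rule tendsto_sandwich[OF _ _ tendsto_const lim]; intro always_eventually allI)
    fix t
    show "0 \<le> excess (v t) (fst (\<sigma> t)) (snd (\<sigma> t))" by (rule nonneg)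
    show "excess (v t) (fst (\<sigma> t)) (snd (\<sigma> t)) \<le> energy (v t) - energy (v (Suc t))"
      using dec[of t] nonneg[of t "snd (\<sigma> t)" "fst (\<sigma> t)"] by linarith
  qed
  show "(\<lambda>t. excess (v t) (snd (\<sigma> t)) (fst (\<sigma> t))) \<longlonglongrightarrow> 0"
  proof (rule tendsto_sandwich[OF _ _ tendsto_const lim]; intro always_eventually allI)
    fix t
    show "0 \<le> excess (v t) (snd (\<sigma> t)) (fst (\<sigma> t))" by (rule nonneg)
    show "excess (v t) (snd (\<sigma> t)) (fst (\<sigma> t)) \<le> energy (v t) - energy (v (Suc t))"
      using dec[of t] nonneg[of t "fst (\<sigma> t)" "snd (\<sigma> t)"] by linarith
  qed
qed

lemma symdiff_Suc_small:
  assumes "d > 0"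
  shows "\<forall>\<^sub>F t in sequentially. \<forall>k. \<mu> ((v t k \<union> v (Suc t) k) - (v t k \<inter> v (Suc t) k)) \<le> d"
proof -
  have d2: "d / 2 > 0" using assms by simp
  obtain \<eta> where \<eta>: "\<eta> > 0" "\<forall>a\<in>Q. \<forall>b\<in>Q. \<forall>A\<in>regions.
    norm (a - b) \<ge> \<epsilon> \<longrightarrow> cost (gain a b) A \<le> \<eta> \<longrightarrow> \<mu> (A - halfplane a b) \<le> d / 2"
    using cost_gain_small[OF pos d2] by (elim exE conjE) (rule that)
  have "\<forall>\<^sub>F t in sequentially. excess (v t) (fst (\<sigma> t)) (snd (\<sigma> t)) < \<eta> \<and>
      excess (v t) (snd (\<sigma> t)) (fst (\<sigma> t)) < \<eta>"
    using order_tendstoD(2)[OF excess_active_tendsto(1) \<eta>(1)] order_tendstoD(2)[OF excess_active_tendsto(2) \<eta>(1)]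
    by (rule eventually_conj)
  then show ?thesis
  proof (rule eventually_mono, intro allI)
    fix t k
    assume ex: "excess (v t) (fst (\<sigma> t)) (snd (\<sigma> t)) < \<eta> \<and> excess (v t) (snd (\<sigma> t)) (fst (\<sigma> t)) < \<eta>"
    obtain i j where ij: "\<sigma> t = (i, j)" by fastforce
    then have "i \<noteq> j"
      using \<sigma>[of t] by (auto simp: gossip_pairs_def)
    have sep: "norm (C (v t i) - C (v t j)) \<ge> \<epsilon>" "norm (C (v t j) - C (v t i)) \<ge> \<epsilon>"
      using reg[of t] \<open>i \<noteq> j\<close> by (auto simp: regular_def)
    then have ne: "C (v t i) \<noteq> C (v t j)"
      using pos by auto
    note r = regular_region[OF reg] and c = regular_centroid(2)[OF pos reg]
    have "\<mu> (v t i - halfplane (C (v t i)) (C (v t j))) \<le> d / 2"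
      using \<eta>(2)[rule_format, OF c c r sep(1)] ex ij by (simp add: excess_def)
    moreover have "\<mu> (v t j - halfplane (C (v t j)) (C (v t i))) \<le> d / 2"
      using \<eta>(2)[rule_format, OF c c r sep(2)] ex ij by (simp add: excess_def)
    ultimately show "\<mu> ((v t k \<union> v (Suc t) k) - (v t k \<inter> v (Suc t) k)) \<le> d"
      using gossip_symdiff_le[of "v t", OF r r \<open>i \<noteq> j\<close> ne, of k] unfolding step ij by linarith
  qed
qed

lemma excess_Suc_tendsto: "(\<lambda>t. excess (v (Suc t)) i j - excess (v t) i j) \<longlonglongrightarrow> 0"
proof (rule LIMSEQ_I)
  fix e :: real assume "e > 0"
  then have "e / 2 > 0" by simp
  obtain d where d: "d > 0" "\<forall>v v' :: 'n \<Rightarrow> (real^2) set. regular \<epsilon> v \<longrightarrow> regular \<epsilon> v' \<longrightarrow>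
    (\<forall>k. \<mu> ((v k \<union> v' k) - (v k \<inter> v' k)) \<le> d) \<longrightarrow> (\<forall>i j. \<bar>excess v i j - excess v' i j\<bar> \<le> e / 2)"
    using excess_close[OF pos \<open>e / 2 > 0\<close>] by (elim exE conjE) (rule that)
  have "\<forall>\<^sub>F t in sequentially. norm (excess (v (Suc t)) i j - excess (v t) i j - 0) < e"
    using symdiff_Suc_small[OF d(1)]
  proof (rule eventually_mono)
    fix t assume "\<forall>k. \<mu> ((v t k \<union> v (Suc t) k) - (v t k \<inter> v (Suc t) k)) \<le> d"
    then have "\<bar>excess (v t) i j - excess (v (Suc t)) i j\<bar> \<le> e / 2"
      using d(2)[rule_format, OF reg reg] by blast
    then show "norm (excess (v (Suc t)) i j - excess (v t) i j - 0) < e"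
      using \<open>e > 0\<close> unfolding real_norm_def abs_minus_commute[of "excess (v t) i j"] by simp
  qed
  then show "\<exists>no. \<forall>t\<ge>no. norm (excess (v (Suc t)) i j - excess (v t) i j - 0) < e"
    unfolding eventually_sequentially .
qed

lemma excess_shift_tendsto: "(\<lambda>t. excess (v (t + k)) i j - excess (v t) i j) \<longlonglongrightarrow> 0"
proof (induction k)
  case (Suc k)
  have "(\<lambda>t. (excess (v (Suc (t + k))) i j - excess (v (t + k)) i j) +
      (excess (v (t + k)) i j - excess (v t) i j)) \<longlonglongrightarrow> 0 + 0"
    by (intro tendsto_add Suc LIMSEQ_ignore_initial_segment[OF excess_Suc_tendsto, simplified])
  then show ?case by simp
qed simp

text \<open>The common core of both cases: at the activation time \<open>t + k\<close> the excess is
  below \<open>e / 2\<close>, and since time \<open>t\<close> it has dropped by less than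
  \<open>e / 2\<close>. Finitely many lags allow one starting time for all of them.\<close>

lemma excess_small_before_active:
  assumes "e > 0"
  shows "\<forall>\<^sub>F t in sequentially. \<forall>k\<le>\<Delta>. \<sigma> (t + k) = (i, j) \<longrightarrow> excess (v t) i j \<le> e"
proof -
  have "\<forall>\<^sub>F t in sequentially. \<sigma> (t + k) = (i, j) \<longrightarrow> excess (v t) i j \<le> e" for k
  proof -
    have "\<forall>\<^sub>F t in sequentially. excess (v (t + k)) (fst (\<sigma> (t + k))) (snd (\<sigma> (t + k))) < e / 2"
      by (rule order_tendstoD(2)[OF LIMSEQ_ignore_initial_segment[OF excess_active_tendsto(1)]])
        (use assms in simp)
    moreover have "\<forall>\<^sub>F t in sequentially. - (e / 2) < excess (v (t + k)) i j - excess (v t) i j"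
      by (rule order_tendstoD(1)[OF excess_shift_tendsto]) (use assms in simp)
    ultimately show ?thesis
      by eventually_elim auto
  qed
  then have "\<forall>\<^sub>F t in sequentially. \<forall>k\<in>{..\<Delta>}. \<sigma> (t + k) = (i, j) \<longrightarrow> excess (v t) i j \<le> e"
    by (intro eventually_ball_finite) auto
  then show ?thesis
    by eventually_elim auto
qed

end

section \<open>Convergence to centroidal Voronoi partitions\<close>

lemma regions_measure_mono:
  "A \<in> regions \<Longrightarrow> D \<in> regions \<Longrightarrow> A \<subseteq> D \<Longrightarrow> \<mu> A \<le> \<mu> D"
  by (intro measure_mono_fmeasurable) (auto dest: regionsD)

lemma voronoi_eq_halfplanes: "voronoi Q c i = Q \<inter> (\<Inter>j\<in>-{i}. halfplane (c i) (c j))"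
  by (auto simp: voronoi_def halfplane_def)

lemma closed_voronoi: "closed (voronoi Q c i)"
  unfolding voronoi_eq_halfplanes
  using compact_Q by (intro closed_Int closed_INT) (auto simp: compact_imp_closed closed_halfplane)

lemma convex_voronoi: "convex (voronoi Q c i)"
  unfolding voronoi_eq_halfplanes
  by (intro convex_Int convex_INT convex_Q convex_halfplane)

lemma voronoi_region: "voronoi Q c i \<in> regions"
  by (rule regions_closed[OF closed_voronoi]) (auto simp: voronoi_def)

text \<open>A closed set without interior lies in its own frontier, which is negligible for a convex
  set; so positive area yields interior points. Two interiors meet in an open subset of a bisector,
  which must be empty.\<close>

lemma voronoi_partition:
  fixes c :: "'n::finite \<Rightarrow> real^2"
  assumes dist: "\<And>i j. i \<noteq> j \<Longrightarrow> c i \<noteq> c j" and pos: "\<And>i. \<mu> (voronoi Q c i) > 0"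
  shows "voronoi Q c \<in> partitions Q"
  unfolding partitions_def
proof (intro CollectI conjI allI impI)
  show "voronoi Q c i \<subseteq> Q" for i
    by (auto simp: voronoi_def)
  show "(\<Union>i. voronoi Q c i) = Q"
  proof (intro equalityI subsetI)
    fix q assume "q \<in> Q"
    obtain i where "\<And>j. norm (q - c i) \<le> norm (q - c j)"
      using ex_is_arg_min_if_finite[of "UNIV :: 'n set" "\<lambda>i. norm (q - c i)"]
      by (auto simp: is_arg_min_def not_less)
    then show "q \<in> (\<Union>i. voronoi Q c i)"
      using \<open>q \<in> Q\<close> by (auto simp: voronoi_def)
  qed (auto simp: voronoi_def)
  show "closed (voronoi Q c i)" for i
    by (rule closed_voronoi)
  show "interior (voronoi Q c i) \<noteq> {}" for i
  proof
    assume "interior (voronoi Q c i) = {}"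
    then have "voronoi Q c i \<subseteq> frontier (voronoi Q c i)"
      using closed_voronoi[of c i] by (simp add: frontier_def)
    then have "negligible (voronoi Q c i)"
      using negligible_convex_frontier[OF convex_voronoi] negligible_subset by blast
    then show False
      using pos[of i] negligible_imp_measure0 by force
  qed
  fix i j :: 'n assume "i \<noteq> j"
  have "interior (voronoi Q c i) \<inter> interior (voronoi Q c j) \<subseteq> {q. norm (c i - q) = norm (c j - q)}"
  proof
    fix q assume "q \<in> interior (voronoi Q c i) \<inter> interior (voronoi Q c j)"
    then have "q \<in> voronoi Q c i" "q \<in> voronoi Q c j"
      using interior_subset by blast+
    then show "q \<in> {q. norm (c i - q) = norm (c j - q)}"
      using \<open>i \<noteq> j\<close> by (force simp: voronoi_def norm_minus_commute intro: antisym)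
  qed
  then have "negligible (interior (voronoi Q c i) \<inter> interior (voronoi Q c j))"
    using negligible_bisector[OF dist[OF \<open>i \<noteq> j\<close>]] negligible_subset by blast
  then show "interior (voronoi Q c i) \<inter> interior (voronoi Q c j) = {}"
    using open_not_negligible[OF open_Int[OF open_interior open_interior]] by blast
qed

text \<open>A misplaced point either lies in some \<open>u j\<close> although another site is
  strictly closer, or is equidistant from two sites. For a point of the Voronoi cell outside
  \<open>u i\<close>, the covering of \<open>Q\<close> supplies that \<open>j\<close>.\<close>

lemma symdiff_voronoi_le:
  fixes u :: "'n::finite \<Rightarrow> (real^2) set"
  assumes u: "\<And>i. u i \<in> regions" "(\<Union>i. u i) = Q" and dist: "\<And>i j. i \<noteq> j \<Longrightarrow> c i \<noteq> c j"
  shows "\<mu> ((u i \<union> voronoi Q c i) - (u i \<inter> voronoi Q c i)) \<le>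
    (\<Sum>(j, k)\<in>gossip_pairs. \<mu> (u j - halfplane (c j) (c k)))"
proof -
  define N where "N = (\<Union>(j, k)\<in>gossip_pairs. {q. norm (c j - q) = norm (c k - q)})"
  have N: "negligible N"
    unfolding N_def
    by (intro negligible_Union) (auto simp: gossip_pairs_def intro!: negligible_bisector dist)
  define T where "T = (\<Union>x\<in>gossip_pairs. u (fst x) - halfplane (c (fst x)) (c (snd x)))"
  have S: "u j - halfplane (c j) (c k) \<in> regions" for j k
    by (rule regions_Int(2)[OF u(1) halfplane_sets])
  have T: "T \<in> sets lebesgue"
    unfolding T_def using S regionsD(1) by (intro sets.finite_UN) auto
  then have "T \<in> regions"
    using regionsD(2)[OF u(1)] by (intro regionsI) (auto simp: T_def)
  have T_I: "q \<in> T" if "q \<in> u j" "q \<notin> halfplane (c j) (c k)" "j \<noteq> k" for q j k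
    unfolding T_def using that by (intro UN_I[of "(j, k)"]) (auto simp: gossip_pairs_def)
  have N_I: "q \<in> N" if "norm (c j - q) = norm (c k - q)" "j \<noteq> k" for q j k
    unfolding N_def using that by (intro UN_I[of "(j, k)"]) (auto simp: gossip_pairs_def)
  have sub: "(u i \<union> voronoi Q c i) - (u i \<inter> voronoi Q c i) \<subseteq> T \<union> N"
  proof
    fix q assume q: "q \<in> (u i \<union> voronoi Q c i) - (u i \<inter> voronoi Q c i)"
    show "q \<in> T \<union> N"
    proof (cases "q \<in> u i")
      case True
      then have "q \<in> Q" "q \<notin> voronoi Q c i"
        using q regionsD(2)[OF u(1)] by auto
      then obtain j where "j \<noteq> i" "q \<notin> halfplane (c i) (c j)"
        by (auto simp: voronoi_def halfplane_def)
      then show ?thesis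
        using T_I[OF True] by blast
    next
      case False
      then have v: "q \<in> voronoi Q c i"
        using q by auto
      then have "q \<in> Q"
        by (simp add: voronoi_def)
      then obtain j where j: "q \<in> u j"
        using u(2) by blast
      then have "j \<noteq> i"
        using False by auto
      show ?thesis
      proof (cases "q \<in> halfplane (c j) (c i)")
        case True
        then have "norm (c j - q) = norm (c i - q)"
          using v \<open>j \<noteq> i\<close> by (simp add: voronoi_def halfplane_def norm_minus_commute order_eq_iff)
        then show ?thesis
          using N_I \<open>j \<noteq> i\<close> by blast
      next
        case False
        then show ?thesis
          using T_I[OF j _ \<open>j \<noteq> i\<close>] by blast
      qed
    qed
  qed
  have "\<mu> ((u i \<union> voronoi Q c i) - (u i \<inter> voronoi Q c i)) \<le> \<mu> (T \<union> N)"
  proof (rule measure_mono_fmeasurable[OF sub])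
    show "(u i \<union> voronoi Q c i) - (u i \<inter> voronoi Q c i) \<in> sets lebesgue"
      by (intro sets.Diff sets.Un sets.Int regionsD(1) u(1) voronoi_region)
    show "T \<union> N \<in> lmeasurable"
      using regionsD(3)[OF \<open>T \<in> regions\<close>] N by (intro fmeasurable.Un) (auto simp: negligible_iff_measure)
  qed
  also have "\<dots> \<le> \<mu> T + \<mu> N"
    using T N by (intro measure_Un_le) (auto simp: negligible_imp_sets)
  also have "\<mu> N = 0"
    by (rule negligible_imp_measure0[OF N])
  also have "\<mu> T \<le> (\<Sum>x\<in>gossip_pairs. \<mu> (u (fst x) - halfplane (c (fst x)) (c (snd x))))"
    unfolding T_def using regionsD(1)[OF S] by (intro measure_UNION_le) auto
  finally show ?thesis
    by (simp add: case_prod_beta)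
qed

lemma bounded_range_vec:
  fixes X :: "nat \<Rightarrow> (real^2)^'n::finite"
  assumes "\<And>t i. X t $ i \<in> Q"
  shows "bounded (range X)"
proof -
  obtain M where M: "\<And>q. q \<in> Q \<Longrightarrow> norm q \<le> M"
    using compact_imp_bounded[OF compact_Q] unfolding bounded_iff by blast
  have "norm (X t) \<le> (\<Sum>i\<in>(UNIV :: 'n set). M)" for t
  proof -
    have "norm (X t) \<le> (\<Sum>i\<in>UNIV. norm (X t $ i))"
      unfolding norm_vec_def by (rule L2_set_le_sum) simp
    also have "\<dots> \<le> (\<Sum>i\<in>(UNIV :: 'n set). M)"
      by (intro sum_mono M assms)
    finally show ?thesis .
  qed
  then show ?thesis
    unfolding bounded_iff by blast
qed

lemma convergent_subsequence:
  fixes v :: "nat \<Rightarrow> 'n::finite \<Rightarrow> (real^2) set"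
  assumes pos: "\<epsilon> > 0" and reg: "\<And>t. regular \<epsilon> (v t)"
    and lim: "\<And>i j. i \<noteq> j \<Longrightarrow> (\<lambda>t. excess (v t) i j) \<longlonglongrightarrow> 0"
  shows "\<exists>w s. strict_mono s \<and> w \<in> centroidal_voronoi Q \<phi> f \<and> (\<lambda>t. d_sym (v (s t)) w) \<longlonglongrightarrow> 0"
proof -
  \<comment> \<open>Collecting the centroids in one vector gives a single subsequence along which
    all of them converge.\<close>
  define X :: "nat \<Rightarrow> (real^2)^'n" where "X t = (\<chi> i. C (v t i))" for t
  note r = regular_region[OF reg] and cQ = regular_centroid(2)[OF pos reg]
  have "bounded (range X)"
    by (rule bounded_range_vec) (simp add: X_def cQ)
  then obtain l s where s: "strict_mono s" and l: "(X \<circ> s) \<longlonglongrightarrow> l"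
    using bounded_imp_convergent_subsequence by blast
  define c where "c i = l $ i" for i
  define u where "u t = v (s t)" for t
  have ru: "u t i \<in> regions" and cu: "C (u t i) \<in> Q" and regu: "regular \<epsilon> (u t)" for t i
    unfolding u_def by (rule r cQ reg)+
  have limc: "(\<lambda>t. C (u t i)) \<longlonglongrightarrow> c i" for i
    using tendsto_vec_nth[OF l, of i] by (simp add: X_def c_def u_def comp_def)
  have c: "c i \<in> Q" for i
    by (rule Lim_in_closed_set[OF compact_imp_closed[OF compact_Q] _ _ limc]) (auto simp: cu)
  have sep: "norm (c i - c j) \<ge> \<epsilon>" if "i \<noteq> j" for i j
  proof -
    have "(\<lambda>t. norm (C (u t i) - C (u t j))) \<longlonglongrightarrow> norm (c i - c j)"
      by (intro tendsto_intros limc)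
    then show ?thesis
      by (rule LIMSEQ_le_const) (use regu that in \<open>auto simp: regular_def\<close>)
  qed
  then have dist: "c i \<noteq> c j" if "i \<noteq> j" for i j
    using that pos by force
  define w where "w = voronoi Q c"
  have w: "w i \<in> regions" for i
    unfolding w_def by (rule voronoi_region)
  \<comment> \<open>The excess refers to the moving centroids; \<open>cost_close\<close>, applied
    with one and the same region, replaces them by their limits, relative to which the misplaced
    area is measured.\<close>
  have shift: "(\<lambda>t. \<mu> (u t i - halfplane (c i) (c j))) \<longlonglongrightarrow> 0" if "i \<noteq> j" for i j
  proof (rule LIMSEQ_I)
    fix e :: real assume "e > 0"
    then have "e / 2 > 0" by simp
    obtain \<eta> where \<eta>: "\<eta> > 0" "\<forall>a\<in>Q. \<forall>b\<in>Q. \<forall>A\<in>regions.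
      norm (a - b) \<ge> \<epsilon> \<longrightarrow> cost (gain a b) A \<le> \<eta> \<longrightarrow> \<mu> (A - halfplane a b) \<le> e / 2"
      using cost_gain_small[OF pos \<open>e / 2 > 0\<close>] by (elim exE conjE) (rule that)
    obtain d where d: "d > 0" "\<forall>a\<in>Q. \<forall>a'\<in>Q. \<forall>b\<in>Q. \<forall>b'\<in>Q. \<forall>A\<in>regions. \<forall>A'\<in>regions.
      norm (a - a') \<le> d \<longrightarrow> norm (b - b') \<le> d \<longrightarrow> \<mu> ((A \<union> A') - (A \<inter> A')) \<le> d \<longrightarrow>
      \<bar>cost (gain a b) A - cost (gain a' b') A'\<bar> \<le> \<eta> / 2"
      using cost_close[OF continuous_gain half_gt_zero[OF \<eta>(1)]] by (elim exE conjE) (rule that)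
    have near: "\<forall>\<^sub>F t in sequentially. norm (c k - C (u t k)) < d" for k
      using tendstoD[OF limc d(1), of k] by (simp add: dist_norm norm_minus_commute)
    have "(\<lambda>t. excess (u t) i j) \<longlonglongrightarrow> 0"
      using LIMSEQ_subseq_LIMSEQ[OF lim[OF that] s] by (simp add: u_def comp_def)
    then have small: "\<forall>\<^sub>F t in sequentially. excess (u t) i j < \<eta> / 2"
      by (rule order_tendstoD(2)) (use \<eta>(1) in simp)
    have "\<forall>\<^sub>F t in sequentially. norm (\<mu> (u t i - halfplane (c i) (c j)) - 0) < e"
      using near[of i] near[of j] small
    proof eventually_elim
      case (elim t)
      have "\<bar>cost (gain (c i) (c j)) (u t i) - cost (gain (C (u t i)) (C (u t j))) (u t i)\<bar> \<le> \<eta> / 2"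
        by (intro d(2)[rule_format] c cu ru) (use elim d(1) in auto)
      then have "cost (gain (c i) (c j)) (u t i) \<le> \<eta>"
        using elim(3) unfolding excess_def by linarith
      then have "\<mu> (u t i - halfplane (c i) (c j)) \<le> e / 2"
        by (intro \<eta>(2)[rule_format] c ru sep that)
      then show ?case
        using \<open>e > 0\<close> by simp
    qed
    then show "\<exists>no. \<forall>t\<ge>no. norm (\<mu> (u t i - halfplane (c i) (c j)) - 0) < e"
      unfolding eventually_sequentially .
  qed
  have sd: "(\<lambda>t. \<mu> ((u t i \<union> w i) - (u t i \<inter> w i))) \<longlonglongrightarrow> 0" for i
  proof (rule tendsto_sandwich[OF _ _ tendsto_const])
    show "\<forall>\<^sub>F t in sequentially. 0 \<le> \<mu> ((u t i \<union> w i) - (u t i \<inter> w i))"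
      by simp
    have "\<mu> ((u t i \<union> w i) - (u t i \<inter> w i)) \<le> (\<Sum>(j, k)\<in>gossip_pairs. \<mu> (u t j - halfplane (c j) (c k)))" for t
      unfolding w_def using regu[of t] by (intro symdiff_voronoi_le ru dist) (auto simp: regular_def partitions_def)
    then show "\<forall>\<^sub>F t in sequentially. \<mu> ((u t i \<union> w i) - (u t i \<inter> w i)) \<le>
        (\<Sum>x\<in>gossip_pairs. \<mu> (u t (fst x) - halfplane (c (fst x)) (c (snd x))))"
      by (simp add: case_prod_beta)
    have "(\<lambda>t. \<Sum>x\<in>gossip_pairs. \<mu> (u t (fst x) - halfplane (c (fst x)) (c (snd x)))) \<longlonglongrightarrow>
        (\<Sum>x\<in>(gossip_pairs :: ('n \<times> 'n) set). 0)"
      by (intro tendsto_sum shift) (auto simp: gossip_pairs_def)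
    then show "(\<lambda>t. \<Sum>x\<in>gossip_pairs. \<mu> (u t (fst x) - halfplane (c (fst x)) (c (snd x)))) \<longlonglongrightarrow> 0"
      by simp
  qed
  \<comment> \<open>Areas do not vanish in the limit; this makes the Voronoi cells a partition and
    their centroids well defined.\<close>
  have w_mass: "\<mu> (w i) \<ge> \<epsilon>" for i
  proof -
    have "(\<lambda>t. \<mu> (w i) + \<mu> ((u t i \<union> w i) - (u t i \<inter> w i))) \<longlonglongrightarrow> \<mu> (w i) + 0"
      by (intro tendsto_intros sd)
    then have "\<epsilon> \<le> \<mu> (w i) + 0"
    proof (rule LIMSEQ_le_const)
      have "\<epsilon> \<le> \<mu> (w i) + \<mu> ((u t i \<union> w i) - (u t i \<inter> w i))" for t
      proof -
        have sdr: "(u t i \<union> w i) - (u t i \<inter> w i) \<in> regions"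
          using ru w regions_ops by blast
        have "\<epsilon> \<le> \<mu> (u t i)"
          using regu[of t] by (simp add: regular_def)
        also have "\<dots> \<le> \<mu> (w i \<union> ((u t i \<union> w i) - (u t i \<inter> w i)))"
          by (rule regions_measure_mono[OF ru regions_ops(1)[OF w sdr]]) auto
        also have "\<dots> \<le> \<mu> (w i) + \<mu> ((u t i \<union> w i) - (u t i \<inter> w i))"
          by (rule measure_Un_le[OF regionsD(1)[OF w] regionsD(1)[OF sdr]])
        finally show ?thesis .
      qed
      then show "\<exists>N. \<forall>n\<ge>N. \<epsilon> \<le> \<mu> (w i) + \<mu> ((u n i \<union> w i) - (u n i \<inter> w i))"
        by blast
    qed
    then show ?thesis by simp
  qed
  then have w_pos: "\<mu> (w i) > 0" for i
    using pos by (meson less_le_trans)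
  \<comment> \<open>The centroid of \<open>u t i\<close> tends to \<open>c i\<close> by choice of
    the subsequence and to the centroid of \<open>w i\<close> by \<open>centroid_close\<close>;
    equality of the limits makes \<open>w\<close> centroidal.\<close>
  have Cw: "C (w i) = c i" for i
  proof -
    have "(\<lambda>t. C (u t i)) \<longlonglongrightarrow> C (w i)"
    proof (rule LIMSEQ_I)
      fix e :: real assume "e > 0"
      obtain \<eta> where \<eta>: "\<eta> > 0" "\<forall>A\<in>regions. \<forall>C\<in>regions. \<forall>a c. centroid a A \<longrightarrow> centroid c C \<longrightarrow>
        \<mu> A \<ge> \<epsilon> \<longrightarrow> \<mu> ((A \<union> C) - (A \<inter> C)) \<le> \<eta> \<longrightarrow> norm (a - c) < e"
        using centroid_close[OF pos \<open>e > 0\<close>] by (elim exE conjE) (rule that)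
      have "\<forall>\<^sub>F t in sequentially. norm (C (u t i) - C (w i)) < e"
        using order_tendstoD(2)[OF sd \<eta>(1), of i]
      proof eventually_elim
        case (elim t)
        show ?case
        proof (rule \<eta>(2)[rule_format, OF ru w])
          show "centroid (C (u t i)) (u t i)"
            by (rule regular_centroid[OF pos regu])
          show "centroid (C (w i)) (w i)"
            by (rule centroid_Cd[OF w w_pos])
          show "\<epsilon> \<le> \<mu> (u t i)"
            using regu[of t] by (simp add: regular_def)
        qed (use elim in simp)
      qed
      then show "\<exists>no. \<forall>t\<ge>no. norm (C (u t i) - C (w i)) < e"
        unfolding eventually_sequentially .
    qed
    then show ?thesis
      using limc LIMSEQ_unique by blast
  qed
  have "w \<in> partitions Q"
    unfolding w_def by (rule voronoi_partition[OF dist w_pos[unfolded w_def]])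
  moreover have "w = voronoi Q (\<lambda>i. C (w i))"
    unfolding Cw by (simp add: w_def)
  ultimately have "w \<in> centroidal_voronoi Q \<phi> f"
    unfolding centroidal_voronoi_def mem_Collect_eq Cw using dist by (intro conjI allI impI)
  moreover have "(\<lambda>t. d_sym (u t) w) \<longlonglongrightarrow> (\<Sum>i\<in>(UNIV :: 'n set). 0)"
    unfolding d_sym_def by (intro tendsto_sum sd)
  ultimately show ?thesis
    using s by (intro exI[of _ w] exI[of _ s]) (simp add: u_def)
qed

text \<open>Otherwise the distance to the set stays at least some positive \<open>a\<close> at
  infinitely many times. The excesses still vanish along these times, and a further subsequence
  converges to a centroidal Voronoi partition, which may vary with the subsequence.\<close>

lemma converges_if_excess_tendsto:
  fixes v :: "nat \<Rightarrow> 'n::finite \<Rightarrow> (real^2) set"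
  assumes pos: "\<epsilon> > 0" and reg: "\<And>t. regular \<epsilon> (v t)"
    and lim: "\<And>i j. i \<noteq> j \<Longrightarrow> (\<lambda>t. excess (v t) i j) \<longlonglongrightarrow> 0"
  shows "converges_to_set v (centroidal_voronoi Q \<phi> f)"
  unfolding converges_to_set_def
proof (rule order_tendstoI)
  let ?F = "\<lambda>t. INF x\<in>centroidal_voronoi Q \<phi> f. ereal (d_sym (v t) x)"
  fix a :: ereal
  assume "a < 0"
  have "0 \<le> ?F t" for t
    by (rule INF_greatest) (simp add: d_sym_def sum_nonneg)
  then have "a < ?F t" for t
    using \<open>a < 0\<close> by (rule less_le_trans[rotated])
  then show "\<forall>\<^sub>F t in sequentially. a < ?F t"
    by simp
next
  let ?F = "\<lambda>t. INF x\<in>centroidal_voronoi Q \<phi> f. ereal (d_sym (v t) x)"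
  fix a :: ereal
  assume "0 < a"
  show "\<forall>\<^sub>F t in sequentially. ?F t < a"
  proof (rule ccontr)
    assume "\<not> ?thesis"
    then have "infinite {t. \<not> ?F t < a}"
      by (simp add: cofinite_eq_sequentially[symmetric] eventually_cofinite)
    then obtain r :: "nat \<Rightarrow> nat" where r: "strict_mono r" "\<And>t. \<not> ?F (r t) < a"
      using infinite_enumerate[of "{t. \<not> ?F t < a}"] by blast
    have "(\<lambda>t. excess (v (r t)) i j) \<longlonglongrightarrow> 0" if "i \<noteq> j" for i j
      using LIMSEQ_subseq_LIMSEQ[OF lim[OF that] r(1)] by (simp add: comp_def)
    from convergent_subsequence[of \<epsilon> "\<lambda>t. v (r t)", OF pos reg this]
    obtain w s where w: "w \<in> centroidal_voronoi Q \<phi> f" and "(\<lambda>t. d_sym (v (r (s t))) w) \<longlonglongrightarrow> 0"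
      by blast
    then have "(\<lambda>t. ereal (d_sym (v (r (s t))) w)) \<longlonglongrightarrow> 0"
      by (simp add: zero_ereal_def)
    then have "\<forall>\<^sub>F t in sequentially. ereal (d_sym (v (r (s t))) w) < a"
      by (rule order_tendstoD(2)) (rule \<open>0 < a\<close>)
    then obtain t where "ereal (d_sym (v (r (s t))) w) < a"
      unfolding eventually_sequentially by blast
    moreover have "?F (r (s t)) \<le> ereal (d_sym (v (r (s t))) w)"
      by (rule INF_lower[OF w])
    ultimately show False
      using r(2)[of "s t"] by (meson le_less_trans)
  qed
qed

end

section \<open>Random persistency\<close>

text \<open>
  The capital of a gambler who, whenever \<open>B n\<close> occurs, stakes everything against \<open>D n\<close> at odds that are
  unfavourable if \<open>D n\<close> has conditional probability at least \<open>p\<close>: a supermartingale that explodes if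
  \<open>B n\<close> occurs infinitely often but never together with \<open>D n\<close>.
\<close>

fun wager :: "real \<Rightarrow> (nat \<Rightarrow> 'w set) \<Rightarrow> (nat \<Rightarrow> 'w set) \<Rightarrow> nat \<Rightarrow> 'w \<Rightarrow> real" where
  "wager p B D 0 \<omega> = 1"
| "wager p B D (Suc n) \<omega> =
    wager p B D n \<omega> * (if \<omega> \<in> B n then (if \<omega> \<in> D n then 0 else 1 / (1 - p)) else 1)"

lemma wager_bounds:
  assumes p: "0 < p" "p < 1"
  shows "0 \<le> wager p B D n \<omega>" "wager p B D n \<omega> \<le> (1 / (1 - p)) ^ n"
proof -
  have r: "1 \<le> 1 / (1 - p)"
    using p by (simp add: field_simps)
  have "0 \<le> wager p B D n \<omega> \<and> wager p B D n \<omega> \<le> (1 / (1 - p)) ^ n"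
  proof (induction n)
    case (Suc n)
    have "wager p B D (Suc n) \<omega> \<le> (1 / (1 - p)) ^ n * (1 / (1 - p))"
      unfolding wager.simps using Suc r p by (intro mult_mono) auto
    moreover have "0 \<le> wager p B D (Suc n) \<omega>"
      using Suc p by simp
    ultimately show ?case
      by (simp add: mult.commute)
  qed simp
  then show "0 \<le> wager p B D n \<omega>" "wager p B D n \<omega> \<le> (1 / (1 - p)) ^ n"
    by auto
qed

text \<open>Every bet is won, so the capital never decreases and gains a factor
  \<open>1 / (1 - p)\<close> at each of infinitely many times.\<close>

lemma wager_large:
  assumes p: "0 < p" "p < 1" and inf: "\<exists>\<^sub>\<infinity>n. \<omega> \<in> B n" and never: "\<And>n. \<omega> \<in> B n \<Longrightarrow> \<omega> \<notin> D n"
  shows "\<forall>\<^sub>F n in sequentially. (1 / (1 - p)) ^ N \<le> wager p B D n \<omega>"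
proof -
  have r: "1 \<le> 1 / (1 - p)"
    using p by (simp add: field_simps)
  have "incseq (\<lambda>n. wager p B D n \<omega>)"
  proof (rule incseq_SucI)
    fix n
    have "wager p B D n \<omega> * 1 \<le> wager p B D n \<omega> * (if \<omega> \<in> B n then (if \<omega> \<in> D n then 0 else 1 / (1 - p)) else 1)"
      using r never wager_bounds(1)[OF p] by (intro mult_left_mono) auto
    then show "wager p B D n \<omega> \<le> wager p B D (Suc n) \<omega>"
      by simp
  qed
  then have mono: "wager p B D m \<omega> \<le> wager p B D n \<omega>" if "m \<le> n" for m n
    using that by (simp add: incseq_def)
  have "\<exists>n. (1 / (1 - p)) ^ N \<le> wager p B D n \<omega>"
  proof (induction N)
    case 0
    show ?case by (intro exI[of _ 0]) simp
  next
    case (Suc N)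
    then obtain m where m: "(1 / (1 - p)) ^ N \<le> wager p B D m \<omega>" by blast
    obtain n where n: "n \<ge> m" "\<omega> \<in> B n"
      using inf unfolding INFM_nat_le by blast
    have "(1 / (1 - p)) ^ Suc N \<le> wager p B D n \<omega> * (1 / (1 - p))"
      unfolding power_Suc2 using m mono[OF n(1)] p by (intro mult_right_mono) auto
    also have "\<dots> = wager p B D (Suc n) \<omega>"
      using n(2) never by simp
    finally show ?case by blast
  qed
  then show ?thesis
    unfolding eventually_sequentially using mono order_trans by blast
qed

context prob_space
begin

context
  fixes G :: "nat \<Rightarrow> 'a measure" and B D :: "nat \<Rightarrow> 'a set" and p :: real
  assumes p: "0 < p" "p < 1"
    and subalg: "\<And>n. subalgebra M (G n)"
    and mono: "\<And>n. sets (G n) \<subseteq> sets (G (Suc n))"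
    and B: "\<And>n. B n \<in> sets (G n)" and D: "\<And>n. D n \<in> sets (G (Suc n))"
    and cond: "\<And>n. AE \<omega> in M. real_cond_exp M (G n) (indicator (D n)) \<omega> \<ge> p"
begin

text \<open>The capital and \<open>B n\<close> are known at stage \<open>n\<close>,
  \<open>D n\<close> only one stage later: the stake is placed before its outcome is
  revealed.\<close>

lemma wager_measurable: "wager p B D n \<in> borel_measurable (G n)"
proof (induction n)
  case (Suc n)
  have "subalgebra (G (Suc n)) (G n)"
    using mono subalg[of n] subalg[of "Suc n"] by (auto simp: subalgebra_def)
  then have [measurable]: "wager p B D n \<in> borel_measurable (G (Suc n))"
    using Suc measurable_from_subalg by blast
  have [measurable]: "B n \<in> sets (G (Suc n))" "D n \<in> sets (G (Suc n))"
    using B D mono by auto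
  show ?case
    by (simp add: fun_eq_iff[symmetric] cong: measurable_cong) measurable
qed simp

text \<open>The stake \<open>?W\<close> is measurable at stage \<open>n\<close> and can be pulled
  out of the conditional expectation, so its integral over \<open>D n\<close> is at least
  \<open>p\<close> times its full integral. At odds \<open>1 / (1 - p)\<close> the expected change
  of capital is then nonpositive.\<close>

lemma expectation_wager: "expectation (wager p B D n) \<le> 1"
proof (induction n)
  case 0
  show ?case by (simp add: prob_space)
next
  case (Suc n)
  interpret F: finite_measure_subalgebra M "G n"
    by standard (rule subalg)
  have sub: "A \<in> events" if "A \<in> sets (G k)" for A k
    using subalg that by (auto simp: subalgebra_def)
  have [measurable]: "wager p B D k \<in> borel_measurable M" for k
    using measurable_from_subalg[OF subalg wager_measurable] .
  have [measurable]: "B n \<in> events" "D n \<in> events"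
    using sub B D by blast+
  have int: "integrable M (wager p B D k)" for k
    by (rule integrable_const_bound[where B = "(1 / (1 - p)) ^ k"])
      (auto intro!: AE_I2 simp: wager_bounds[OF p])
  let ?W = "\<lambda>\<omega>. wager p B D n \<omega> * indicator (B n) \<omega>"
  have intW: "integrable M ?W"
    by (rule integrable_real_mult_indicator) (auto simp: int)
  have intWD: "integrable M (\<lambda>\<omega>. ?W \<omega> * indicator (D n) \<omega>)"
    by (rule integrable_real_mult_indicator) (auto simp: intW)
  have W_meas: "?W \<in> borel_measurable (G n)"
    using wager_measurable B by measurable
  have iD: "(indicator (D n) :: 'a \<Rightarrow> real) \<in> borel_measurable M"
    by measurable
  note ce = F.real_cond_exp_intg[OF intWD W_meas iD]
  have "(\<integral>\<omega>. p * ?W \<omega> \<partial>M) \<le> (\<integral>\<omega>. ?W \<omega> * real_cond_exp M (G n) (indicator (D n)) \<omega> \<partial>M)"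
  proof (rule integral_mono_AE)
    show "AE \<omega> in M. p * ?W \<omega> \<le> ?W \<omega> * real_cond_exp M (G n) (indicator (D n)) \<omega>"
      using cond[of n]
    proof eventually_elim
      case (elim \<omega>)
      then have "?W \<omega> * p \<le> ?W \<omega> * real_cond_exp M (G n) (indicator (D n)) \<omega>"
        by (intro mult_left_mono) (simp_all add: wager_bounds(1)[OF p])
      then show ?case by (simp add: mult.commute)
    qed
  qed (use ce(1) intW in auto)
  then have key: "p * (\<integral>\<omega>. ?W \<omega> \<partial>M) \<le> (\<integral>\<omega>. ?W \<omega> * indicator (D n) \<omega> \<partial>M)"
    using ce(2) by simp
  \<comment> \<open>The case distinction in linear form: \<open>1 / (1 - p)\<close> equals
    \<open>1 + p / (1 - p)\<close>, and the last term takes everything away when \<open>D n\<close>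
    occurs.\<close>
  have "wager p B D (Suc n) \<omega> =
      wager p B D n \<omega> + (p / (1 - p)) * ?W \<omega> - (1 / (1 - p)) * (?W \<omega> * indicator (D n) \<omega>)" for \<omega>
  proof -
    have "p / (1 - p) = 1 / (1 - p) - 1"
      using p by (simp add: field_simps)
    then show ?thesis
      unfolding wager.simps by (simp only:) (simp add: indicator_def left_diff_distrib)
  qed
  then have "expectation (wager p B D (Suc n)) =
      (\<integral>\<omega>. wager p B D n \<omega> + (p / (1 - p)) * ?W \<omega> - (1 / (1 - p)) * (?W \<omega> * indicator (D n) \<omega>) \<partial>M)"
    by (intro Bochner_Integration.integral_cong) auto
  also have "\<dots> = expectation (wager p B D n) + (p / (1 - p)) * (\<integral>\<omega>. ?W \<omega> \<partial>M) -
      (1 / (1 - p)) * (\<integral>\<omega>. ?W \<omega> * indicator (D n) \<omega> \<partial>M)"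
    using int[of n] intW intWD by simp
  also have "(p / (1 - p)) * (\<integral>\<omega>. ?W \<omega> \<partial>M) = (1 / (1 - p)) * (p * (\<integral>\<omega>. ?W \<omega> \<partial>M))"
    by simp
  also have "expectation (wager p B D n) + (1 / (1 - p)) * (p * (\<integral>\<omega>. ?W \<omega> \<partial>M)) -
      (1 / (1 - p)) * (\<integral>\<omega>. ?W \<omega> * indicator (D n) \<omega> \<partial>M) \<le> expectation (wager p B D n)"
    using mult_left_mono[OF key, of "1 / (1 - p)"] p by simp
  finally show ?case
    using Suc by simp
qed

text \<open>By Fatou's lemma the limit inferior of the capital has integral at most 1 and is almost
  everywhere finite, whereas on the excluded event the capital eventually stays above every power of
  \<open>1 / (1 - p)\<close>.\<close>

lemma never_hit_null: "AE \<omega> in M. \<not> ((\<exists>\<^sub>\<infinity>n. \<omega> \<in> B n) \<and> (\<forall>n. \<omega> \<in> B n \<longrightarrow> \<omega> \<notin> D n))"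
proof -
  have meas [measurable]: "wager p B D k \<in> borel_measurable M" for k
    using measurable_from_subalg[OF subalg wager_measurable] .
  have int: "integrable M (wager p B D k)" for k
    by (rule integrable_const_bound[where B = "(1 / (1 - p)) ^ k"])
      (auto intro!: AE_I2 simp: wager_bounds[OF p])
  have le1: "(\<integral>\<^sup>+\<omega>. ennreal (wager p B D n \<omega>) \<partial>M) \<le> 1" for n
  proof -
    have "(\<integral>\<^sup>+\<omega>. ennreal (wager p B D n \<omega>) \<partial>M) = ennreal (expectation (wager p B D n))"
      by (rule nn_integral_eq_integral[OF int]) (simp add: wager_bounds(1)[OF p])
    then show ?thesis
      using expectation_wager[of n] by (simp add: ennreal_le_1)
  qed
  have "(\<integral>\<^sup>+\<omega>. liminf (\<lambda>n. ennreal (wager p B D n \<omega>)) \<partial>M) \<le>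
      liminf (\<lambda>n. \<integral>\<^sup>+\<omega>. ennreal (wager p B D n \<omega>) \<partial>M)"
    by (rule nn_integral_liminf) measurable
  also have "\<dots> \<le> 1"
    by (rule Liminf_le) (use le1 in auto)
  finally have "(\<integral>\<^sup>+\<omega>. liminf (\<lambda>n. ennreal (wager p B D n \<omega>)) \<partial>M) \<noteq> \<infinity>"
    by (metis ennreal_one_neq_top infinity_ennreal_def neq_top_trans)
  then have "AE \<omega> in M. liminf (\<lambda>n. ennreal (wager p B D n \<omega>)) \<noteq> \<infinity>"
    by (intro nn_integral_PInf_AE) measurable
  then show ?thesis
  proof eventually_elim
    case (elim \<omega>)
    show ?case
    proof
      assume *: "(\<exists>\<^sub>\<infinity>n. \<omega> \<in> B n) \<and> (\<forall>n. \<omega> \<in> B n \<longrightarrow> \<omega> \<notin> D n)"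
      obtain x where x: "x \<ge> 0" "liminf (\<lambda>n. ennreal (wager p B D n \<omega>)) = ennreal x"
        using elim by (cases "liminf (\<lambda>n. ennreal (wager p B D n \<omega>))") auto
      have "1 / (1 - p) > 1"
        using p by (simp add: field_simps)
      then obtain N where N: "x < (1 / (1 - p)) ^ N"
        using real_arch_pow by blast
      have "\<forall>\<^sub>F n in sequentially. (1 / (1 - p)) ^ N \<le> wager p B D n \<omega>"
        using * by (intro wager_large[OF p]) auto
      then have "\<forall>\<^sub>F n in sequentially. ennreal ((1 / (1 - p)) ^ N) \<le> ennreal (wager p B D n \<omega>)"
        by eventually_elim (rule ennreal_leI)
      then have "ennreal ((1 / (1 - p)) ^ N) \<le> ennreal x"
        unfolding x(2)[symmetric] by (rule Liminf_bounded)
      then show False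
        using N x(1) by simp
    qed
  qed
qed

end

text \<open>Ruling out that no hit ever occurs, for every tail of the sequence, yields infinitely
  many hits; the countably many tails share one null set.\<close>

lemma conditional_Borel_Cantelli:
  fixes G :: "nat \<Rightarrow> 'a measure" and B D :: "nat \<Rightarrow> 'a set"
  assumes p: "0 < p" "p < 1"
    and subalg: "\<And>n. subalgebra M (G n)"
    and mono: "\<And>n. sets (G n) \<subseteq> sets (G (Suc n))"
    and B: "\<And>n. B n \<in> sets (G n)" and D: "\<And>n. D n \<in> sets (G (Suc n))"
    and cond: "\<And>n. AE \<omega> in M. real_cond_exp M (G n) (indicator (D n)) \<omega> \<ge> p"
  shows "AE \<omega> in M. (\<exists>\<^sub>\<infinity>n. \<omega> \<in> B n) \<longrightarrow> (\<exists>\<^sub>\<infinity>n. \<omega> \<in> B n \<inter> D n)"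
proof -
  have "AE \<omega> in M. \<forall>m. \<not> ((\<exists>\<^sub>\<infinity>n. \<omega> \<in> B (n + m)) \<and> (\<forall>n. \<omega> \<in> B (n + m) \<longrightarrow> \<omega> \<notin> D (n + m)))"
    unfolding AE_all_countable
  proof
    fix m
    show "AE \<omega> in M. \<not> ((\<exists>\<^sub>\<infinity>n. \<omega> \<in> B (n + m)) \<and> (\<forall>n. \<omega> \<in> B (n + m) \<longrightarrow> \<omega> \<notin> D (n + m)))"
      using never_hit_null[of p "\<lambda>n. G (n + m)" "\<lambda>n. B (n + m)" "\<lambda>n. D (n + m)"] assms by simp
  qed
  then show ?thesis
  proof eventually_elim
    case (elim \<omega>)
    show ?case
    proof
      assume inf: "\<exists>\<^sub>\<infinity>n. \<omega> \<in> B n"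
      show "\<exists>\<^sub>\<infinity>n. \<omega> \<in> B n \<inter> D n"
        unfolding INFM_nat_le
      proof
        fix m
        have "\<exists>\<^sub>\<infinity>n. \<omega> \<in> B (n + m)"
          unfolding INFM_nat_le
        proof
          fix k
          obtain n where "n \<ge> k + m" "\<omega> \<in> B n"
            using inf unfolding INFM_nat_le by blast
          then show "\<exists>n\<ge>k. \<omega> \<in> B (n + m)"
            by (intro exI[of _ "n - m"]) auto
        qed
        then obtain n where "\<omega> \<in> B (n + m)" "\<omega> \<in> D (n + m)"
          using elim by blast
        then show "\<exists>n\<ge>m. \<omega> \<in> B n \<inter> D n"
          by (intro exI[of _ "n + m"]) auto
      qed
    qed
  qed
qed

end

section \<open>Events determined by the history of a process with finitely many states\<close>

lemma sets_PiM_count_space_finite: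
  assumes "finite I" "finite X" "A \<subseteq> PiE I (\<lambda>_. X)"
  shows "A \<in> sets (Pi\<^sub>M I (\<lambda>_. count_space X))"
proof -
  have "finite A"
    using assms finite_PiE[of I "\<lambda>_. X"] finite_subset by blast
  have "{h} \<in> sets (Pi\<^sub>M I (\<lambda>_. count_space X))" if "h \<in> A" for h
  proof -
    have "h \<in> PiE I (\<lambda>_. X)"
      using that assms(3) by blast
    then have "{h} = PiE I (\<lambda>i. {h i})"
      by (intro PiE_singleton[symmetric]) (auto simp: PiE_def)
    moreover have "PiE I (\<lambda>i. {h i}) \<in> sets (Pi\<^sub>M I (\<lambda>_. count_space X))"
      using \<open>h \<in> PiE I (\<lambda>_. X)\<close> assms(1) by (intro sets_PiM_I_finite) auto
    ultimately show ?thesis by simp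
  qed
  then have "(\<Union>h\<in>A. {h}) \<in> sets (Pi\<^sub>M I (\<lambda>_. count_space X))"
    using \<open>finite A\<close> by (intro sets.finite_UN) auto
  then show ?thesis by simp
qed

context
  fixes M :: "'w measure" and X :: "'x set" and \<sigma> :: "nat \<Rightarrow> 'w \<Rightarrow> 'x"
  assumes X: "finite X" and \<sigma>: "\<And>t. \<sigma> t \<in> measurable M (count_space X)"
begin

lemma history_in_space: "(\<lambda>\<omega>. \<lambda>s\<in>{1..t}. \<sigma> s \<omega>) \<in> space M \<rightarrow> space (Pi\<^sub>M {1..t} (\<lambda>_. count_space X))"
  using measurable_space[OF \<sigma>] by (auto simp: space_PiM)

text \<open>Histories up to \<open>t\<close> take finitely many values, so the product algebra on
  them is discrete and every predicate \<open>R\<close> is admissible. This is what admits events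
  about partitions and their excesses.\<close>

lemma history_algebra_predicate:
  "{\<omega> \<in> space M. R (\<lambda>s\<in>{1..t}. \<sigma> s \<omega>)} \<in> sets (history_algebra M X \<sigma> t)"
proof -
  let ?A = "{h \<in> PiE {1..t} (\<lambda>_. X). R h}"
  have "?A \<in> sets (Pi\<^sub>M {1..t} (\<lambda>_. count_space X))"
    by (rule sets_PiM_count_space_finite) (auto simp: X)
  then have "(\<lambda>\<omega>. \<lambda>s\<in>{1..t}. \<sigma> s \<omega>) -` ?A \<inter> space M \<in> sets (history_algebra M X \<sigma> t)"
    unfolding history_algebra_def by (rule in_vimage_algebra)
  moreover have "(\<lambda>\<omega>. \<lambda>s\<in>{1..t}. \<sigma> s \<omega>) -` ?A \<inter> space M = {\<omega> \<in> space M. R (\<lambda>s\<in>{1..t}. \<sigma> s \<omega>)}"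
    using measurable_space[OF \<sigma>] by auto
  ultimately show ?thesis by simp
qed

lemma history_algebra_mono:
  assumes "s \<le> t"
  shows "sets (history_algebra M X \<sigma> s) \<subseteq> sets (history_algebra M X \<sigma> t)"
proof
  fix S assume "S \<in> sets (history_algebra M X \<sigma> s)"
  then obtain A where S: "S = (\<lambda>\<omega>. \<lambda>r\<in>{1..s}. \<sigma> r \<omega>) -` A \<inter> space M"
    unfolding history_algebra_def sets_vimage_algebra2[OF history_in_space] by blast
  have "restrict (\<lambda>r\<in>{1..t}. \<sigma> r \<omega>) {1..s} = (\<lambda>r\<in>{1..s}. \<sigma> r \<omega>)" for \<omega>
    using assms by (auto simp: restrict_def fun_eq_iff)
  then have "S = {\<omega> \<in> space M. restrict (\<lambda>r\<in>{1..t}. \<sigma> r \<omega>) {1..s} \<in> A}"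
    unfolding S by auto
  then show "S \<in> sets (history_algebra M X \<sigma> t)"
    using history_algebra_predicate[of "\<lambda>h. restrict h {1..s} \<in> A" t] by simp
qed

lemma subalgebra_history: "subalgebra M (history_algebra M X \<sigma> t)"
  unfolding subalgebra_def
proof
  show "space (history_algebra M X \<sigma> t) = space M"
    by (simp add: history_algebra_def)
  show "sets (history_algebra M X \<sigma> t) \<subseteq> sets M"
    unfolding history_algebra_def
    by (rule sets_image_in_sets[OF refl]) (intro measurable_restrict \<sigma>)
qed

lemma history_algebra_state:
  assumes "1 \<le> s" "s \<le> t"
  shows "{\<omega> \<in> space M. \<sigma> s \<omega> = x} \<in> sets (history_algebra M X \<sigma> t)"
  using history_algebra_predicate[of "\<lambda>h. h s = x" t] assms by simp

end

text \<open>The bound \<open>\<Delta>\<close> is fixed before \<open>R\<close>, so it does not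
  depend on the property of the history whose recurrence is tested.\<close>

lemma randomly_persistent_hits:
  assumes rp: "randomly_persistent M X \<sigma>" and x: "x \<in> X"
  shows "\<exists>\<Delta>. \<forall>R. AE \<omega> in M. (\<exists>\<^sub>\<infinity>t. R t (\<lambda>s\<in>{1..t}. \<sigma> s \<omega>)) \<longrightarrow>
    (\<exists>\<^sub>\<infinity>t. R t (\<lambda>s\<in>{1..t}. \<sigma> s \<omega>) \<and> (\<exists>k\<le>\<Delta>. \<sigma> (t + k) \<omega> = x))"
proof -
  interpret prob_space M
    using rp by (simp add: randomly_persistent_def)
  have X: "finite X" and \<sigma>: "\<And>t. \<sigma> t \<in> measurable M (count_space X)"
    using rp by (simp_all add: randomly_persistent_def)
  obtain p \<Delta> where p: "0 < p" "p < 1" and per: "\<forall>x\<in>X. \<forall>t. \<exists>k\<in>{1..\<Delta>}. AE \<omega> in M.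
      real_cond_exp M (history_algebra M X \<sigma> t) (indicator {\<omega>' \<in> space M. \<sigma> (t + k) \<omega>' = x}) \<omega> \<ge> p"
    using rp unfolding randomly_persistent_def by blast
  from per x have "\<forall>t. \<exists>k. k \<in> {1..\<Delta>} \<and> (AE \<omega> in M.
      real_cond_exp M (history_algebra M X \<sigma> t) (indicator {\<omega>' \<in> space M. \<sigma> (t + k) \<omega>' = x}) \<omega> \<ge> p)"
    by blast
  \<comment> \<open>For the fixed \<open>x\<close> the lag is a deterministic function of
    \<open>t\<close>, so the event \<open>D t\<close> below concerns a single nonrandom
    time.\<close>
  then obtain k where k: "\<And>t. k t \<in> {1..\<Delta>}" and cond: "\<And>t. AE \<omega> in M.
      real_cond_exp M (history_algebra M X \<sigma> t) (indicator {\<omega>' \<in> space M. \<sigma> (t + k t) \<omega>' = x}) \<omega> \<ge> p"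
    by metis
  have \<Delta>: "\<Delta> \<ge> 1"
    using k[of 0] by simp
  show ?thesis
  proof (intro exI[of _ \<Delta>] allI)
    fix R :: "nat \<Rightarrow> (nat \<Rightarrow> 'b) \<Rightarrow> bool"
    define B where "B t = {\<omega> \<in> space M. R t (\<lambda>s\<in>{1..t}. \<sigma> s \<omega>)}" for t
    define D where "D t = {\<omega> \<in> space M. \<sigma> (t + k t) \<omega> = x}" for t
    \<comment> \<open>Since \<open>D t\<close> is only decided at time \<open>t + \<Delta>\<close>, the residue classes of times modulo \<open>\<Delta>\<close> are treated separately.\<close>
    have "AE \<omega> in M. \<forall>r. (\<exists>\<^sub>\<infinity>n. \<omega> \<in> B (r + n * \<Delta>)) \<longrightarrow> (\<exists>\<^sub>\<infinity>n. \<omega> \<in> B (r + n * \<Delta>) \<inter> D (r + n * \<Delta>))"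
      unfolding AE_all_countable
    proof
      fix r
      show "AE \<omega> in M. (\<exists>\<^sub>\<infinity>n. \<omega> \<in> B (r + n * \<Delta>)) \<longrightarrow> (\<exists>\<^sub>\<infinity>n. \<omega> \<in> B (r + n * \<Delta>) \<inter> D (r + n * \<Delta>))"
      proof (rule conditional_Borel_Cantelli[OF p, of "\<lambda>n. history_algebra M X \<sigma> (r + n * \<Delta>)"])
        fix n
        show "subalgebra M (history_algebra M X \<sigma> (r + n * \<Delta>))"
          by (rule subalgebra_history[OF X \<sigma>])
        show "sets (history_algebra M X \<sigma> (r + n * \<Delta>)) \<subseteq> sets (history_algebra M X \<sigma> (r + Suc n * \<Delta>))"
          by (rule history_algebra_mono[OF X \<sigma>]) simp
        show "B (r + n * \<Delta>) \<in> sets (history_algebra M X \<sigma> (r + n * \<Delta>))"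
          unfolding B_def by (rule history_algebra_predicate[OF X \<sigma>])
        \<comment> \<open>Lags lie between 1 and \<open>\<Delta>\<close>: the observed time is
          positive, hence recorded in the history, and does not exceed the next time of the residue
          class.\<close>
        show "D (r + n * \<Delta>) \<in> sets (history_algebra M X \<sigma> (r + Suc n * \<Delta>))"
          unfolding D_def by (rule history_algebra_state[OF X \<sigma>]) (use k[of "r + n * \<Delta>"] in auto)
        show "AE \<omega> in M. p \<le> real_cond_exp M (history_algebra M X \<sigma> (r + n * \<Delta>)) (indicator (D (r + n * \<Delta>))) \<omega>"
          unfolding D_def by (rule cond)
      qed
    qed
    then show "AE \<omega> in M. (\<exists>\<^sub>\<infinity>t. R t (\<lambda>s\<in>{1..t}. \<sigma> s \<omega>)) \<longrightarrow>
      (\<exists>\<^sub>\<infinity>t. R t (\<lambda>s\<in>{1..t}. \<sigma> s \<omega>) \<and> (\<exists>k\<le>\<Delta>. \<sigma> (t + k) \<omega> = x))"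
      using AE_space
    proof eventually_elim
      case (elim \<omega>)
      show ?case
      proof
        assume inf: "\<exists>\<^sub>\<infinity>t. R t (\<lambda>s\<in>{1..t}. \<sigma> s \<omega>)"
        let ?S = "{t. \<omega> \<in> B t}"
        have "infinite ?S"
          using inf elim(2) by (simp add: B_def INFM_iff_infinite)
        moreover have "?S \<subseteq> (\<Union>r<\<Delta>. (\<lambda>n. r + n * \<Delta>) ` {n. \<omega> \<in> B (r + n * \<Delta>)})"
        proof
          fix t assume t: "t \<in> ?S"
          have "t mod \<Delta> < \<Delta>" and eq: "t = t mod \<Delta> + (t div \<Delta>) * \<Delta>"
            using \<Delta> by auto
          then show "t \<in> (\<Union>r<\<Delta>. (\<lambda>n. r + n * \<Delta>) ` {n. \<omega> \<in> B (r + n * \<Delta>)})"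
            using t by (intro UN_I[of "t mod \<Delta>"] image_eqI[of _ _ "t div \<Delta>"]) auto
        qed
        ultimately have "infinite (\<Union>r<\<Delta>. (\<lambda>n. r + n * \<Delta>) ` {n. \<omega> \<in> B (r + n * \<Delta>)})"
          using finite_subset by blast
        then obtain r where "infinite {n. \<omega> \<in> B (r + n * \<Delta>)}"
          by (meson finite_UN_I finite_imageI finite_lessThan)
        then have "\<exists>\<^sub>\<infinity>n. \<omega> \<in> B (r + n * \<Delta>)"
          by (simp add: INFM_iff_infinite)
        then have hit: "\<exists>\<^sub>\<infinity>n. \<omega> \<in> B (r + n * \<Delta>) \<inter> D (r + n * \<Delta>)"
          using elim(1) by blast
        show "\<exists>\<^sub>\<infinity>t. R t (\<lambda>s\<in>{1..t}. \<sigma> s \<omega>) \<and> (\<exists>k\<le>\<Delta>. \<sigma> (t + k) \<omega> = x)"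
          unfolding INFM_nat_le
        proof
          fix m
          obtain n where n: "n \<ge> m" "\<omega> \<in> B (r + n * \<Delta>) \<inter> D (r + n * \<Delta>)"
            using hit unfolding INFM_nat_le by blast
          have "m \<le> n * \<Delta>"
            using n(1) \<Delta> by (metis le_trans mult.right_neutral mult_le_mono2)
          then show "\<exists>t\<ge>m. R t (\<lambda>s\<in>{1..t}. \<sigma> s \<omega>) \<and> (\<exists>k\<le>\<Delta>. \<sigma> (t + k) \<omega> = x)"
            using n(2) k[of "r + n * \<Delta>"]
            by (intro exI[of _ "r + n * \<Delta>"] conjI exI[of _ "k (r + n * \<Delta>)"]) (auto simp: B_def D_def)
        qed
      qed
    qed
  qed
qed

section \<open>Evolutions as functions of the active pairs, and the two kinds of persistency\<close>

primrec gossip_orbit where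
  "gossip_orbit Q \<phi> f v0 \<sigma> 0 = v0"
| "gossip_orbit Q \<phi> f v0 \<sigma> (Suc t) = gossip_map Q \<phi> f (\<sigma> t) (gossip_orbit Q \<phi> f v0 \<sigma> t)"

text \<open>The partition at time \<open>t\<close> depends only on pairs active before
  \<open>t\<close>; once the value of \<open>\<sigma> 0\<close> is fixed, it is therefore a function
  of the history up to \<open>t\<close>.\<close>

lemma gossip_orbit_cong:
  assumes "\<And>s. s < t \<Longrightarrow> \<sigma> s = \<sigma>' s"
  shows "gossip_orbit Q \<phi> f v0 \<sigma> t = gossip_orbit Q \<phi> f v0 \<sigma>' t"
  using assms by (induction t) auto

lemma gossip_evolution_orbit:
  assumes "gossip_evolution Q \<phi> f \<sigma> v"
  shows "v t = gossip_orbit Q \<phi> f (v 0) \<sigma> t"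
  using assms by (induction t) (simp_all add: gossip_evolution_def)

text \<open>The first listed time at or after \<open>t\<close> is within \<open>\<Delta>\<close> of
  \<open>t\<close>, because its predecessor in the list comes before \<open>t\<close>. The bound
  starts at \<open>\<tau> 0\<close>, as the wait for the first listed time is not
  controlled.\<close>

lemma uniformly_persistent_hits:
  assumes "uniformly_persistent X \<sigma>" "x \<in> X"
  shows "\<exists>\<Delta>. \<forall>\<^sub>F t in sequentially. \<exists>k\<le>\<Delta>. \<sigma> (t + k) = x"
proof -
  obtain \<Delta> \<tau> where \<tau>: "strict_mono (\<tau> :: nat \<Rightarrow> nat)" "\<And>k. \<tau> (Suc k) - \<tau> k \<le> \<Delta>" "\<And>k. \<sigma> (\<tau> k) = x"
    using assms unfolding uniformly_persistent_def by blast
  have "\<exists>k\<le>\<Delta>. \<sigma> (t + k) = x" if "t \<ge> \<tau> 0" for t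
  proof -
    define n where "n = (LEAST n. t \<le> \<tau> n)"
    have n: "t \<le> \<tau> n"
      unfolding n_def by (rule LeastI[of _ t]) (rule strict_mono_imp_increasing[OF \<tau>(1)])
    have "\<tau> n \<le> t + \<Delta>"
    proof (cases n)
      case 0
      then show ?thesis using that by simp
    next
      case (Suc m)
      then have "\<not> t \<le> \<tau> m"
        using not_less_Least[of m "\<lambda>n. t \<le> \<tau> n"] unfolding n_def by simp
      then show ?thesis
        using \<tau>(2)[of m] Suc by simp
    qed
    then show ?thesis
      using n \<tau>(3)[of n] by (intro exI[of _ "\<tau> n - t"]) auto
  qed
  then show ?thesis
    unfolding eventually_sequentially by blast
qed

context coverage
begin

lemma excess_tendstoI:
  assumes reg: "\<And>t. regular \<epsilon> (v t)" and le: "\<And>e. e > 0 \<Longrightarrow> \<forall>\<^sub>F t in sequentially. excess (v t) i j \<le> e"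
  shows "(\<lambda>t. excess (v t) i j) \<longlonglongrightarrow> 0"
proof (rule order_tendstoI)
  fix a :: real assume "a < 0"
  then show "\<forall>\<^sub>F t in sequentially. a < excess (v t) i j"
    using excess_nonneg[OF reg] by (intro always_eventually allI) (rule less_le_trans)
next
  fix a :: real assume "0 < a"
  then have "\<forall>\<^sub>F t in sequentially. excess (v t) i j \<le> a / 2"
    by (intro le) simp
  then show "\<forall>\<^sub>F t in sequentially. excess (v t) i j < a"
    by eventually_elim (use \<open>0 < a\<close> in linarith)
qed

lemma uniformly_persistent_converges:
  fixes v :: "nat \<Rightarrow> 'n::finite \<Rightarrow> (real^2) set"
  assumes up: "uniformly_persistent gossip_pairs \<sigma>" and ev: "gossip_evolution Q \<phi> f \<sigma> v"
    and nd: "nondegenerate Q \<phi> f v"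
  shows "converges_to_set v (centroidal_voronoi Q \<phi> f)"
proof -
  have part: "v t \<in> partitions Q" and step: "v (Suc t) = gossip_map Q \<phi> f (\<sigma> t) (v t)" for t
    using ev by (simp_all add: gossip_evolution_def)
  obtain \<epsilon> where pos: "\<epsilon> > 0" and "\<forall>t. regular \<epsilon> (v t)"
    using nondegenerate_regular[OF part nd] by (elim exE conjE) (rule that)
  then have reg: "regular \<epsilon> (v t)" for t
    by blast
  have \<sigma>: "\<sigma> t \<in> gossip_pairs" for t
    using up by (simp add: uniformly_persistent_def)
  show ?thesis
  proof (rule converges_if_excess_tendsto[OF pos reg])
    fix i j :: 'n assume "i \<noteq> j"
    then have "(i, j) \<in> gossip_pairs"
      by (simp add: gossip_pairs_def)
    then obtain \<Delta> where hit: "\<forall>\<^sub>F t in sequentially. \<exists>k\<le>\<Delta>. \<sigma> (t + k) = (i, j)"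
      using uniformly_persistent_hits[OF up] by blast
    show "(\<lambda>t. excess (v t) i j) \<longlonglongrightarrow> 0"
    proof (rule excess_tendstoI[OF reg])
      fix e :: real assume "e > 0"
      show "\<forall>\<^sub>F t in sequentially. excess (v t) i j \<le> e"
        using hit excess_small_before_active[where v = v and \<sigma> = \<sigma>, OF pos reg \<sigma> step \<open>e > 0\<close>, of \<Delta> i j]
        by eventually_elim blast
    qed
  qed
qed

text \<open>Recurrence is settled almost surely on the whole space, with no reference to
  non-degeneracy. On a non-degenerate path, recurrence of a large excess then contradicts
  \<open>excess_small_before_active\<close>, whose \<open>\<epsilon>\<close> may vary with the
  path.\<close>

lemma randomly_persistent_converges:
  fixes v :: "nat \<Rightarrow> 'w \<Rightarrow> 'n::finite \<Rightarrow> (real^2) set"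
  assumes rp: "randomly_persistent M gossip_pairs \<sigma>"
    and ev: "\<And>\<omega>. \<omega> \<in> space M \<Longrightarrow> v 0 \<omega> = v0 \<and> gossip_evolution Q \<phi> f (\<lambda>t. \<sigma> t \<omega>) (\<lambda>t. v t \<omega>)"
  shows "AE \<omega> in M. nondegenerate Q \<phi> f (\<lambda>t. v t \<omega>) \<longrightarrow>
    converges_to_set (\<lambda>t. v t \<omega>) (centroidal_voronoi Q \<phi> f)"
proof -
  \<comment> \<open>The history algebras do not contain \<open>\<sigma> 0\<close>, so its finitely many values \<open>s\<close> are treated one by one.\<close>
  define E where "E h s t = gossip_orbit Q \<phi> f v0 (h(0 := s)) t" for h :: "nat \<Rightarrow> 'n \<times> 'n" and s t
  have "\<forall>x\<in>gossip_pairs. \<exists>\<Delta>. \<forall>R. AE \<omega> in M. (\<exists>\<^sub>\<infinity>t. R t (\<lambda>s\<in>{1..t}. \<sigma> s \<omega>)) \<longrightarrow>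
    (\<exists>\<^sub>\<infinity>t. R t (\<lambda>s\<in>{1..t}. \<sigma> s \<omega>) \<and> (\<exists>k\<le>\<Delta>. \<sigma> (t + k) \<omega> = x))"
    by (intro ballI randomly_persistent_hits[OF rp])
  from bchoice[OF this]
  obtain \<Delta> where \<Delta>: "\<forall>x\<in>gossip_pairs. \<forall>R. AE \<omega> in M. (\<exists>\<^sub>\<infinity>t. R t (\<lambda>s\<in>{1..t}. \<sigma> s \<omega>)) \<longrightarrow>
    (\<exists>\<^sub>\<infinity>t. R t (\<lambda>s\<in>{1..t}. \<sigma> s \<omega>) \<and> (\<exists>k\<le>\<Delta> x. \<sigma> (t + k) \<omega> = x))"
    by (elim exE) (rule that)
  \<comment> \<open>Thresholds \<open>1 / Suc m\<close>, pairs and possible values of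
    \<open>\<sigma> 0\<close> are countable in number, so one null set serves all of them.\<close>
  have "AE \<omega> in M. \<forall>m. \<forall>x\<in>gossip_pairs. \<forall>s\<in>UNIV.
    (\<exists>\<^sub>\<infinity>t. excess (E (\<lambda>s\<in>{1..t}. \<sigma> s \<omega>) s t) (fst x) (snd x) > 1 / Suc m) \<longrightarrow>
    (\<exists>\<^sub>\<infinity>t. excess (E (\<lambda>s\<in>{1..t}. \<sigma> s \<omega>) s t) (fst x) (snd x) > 1 / Suc m \<and>
      (\<exists>k\<le>\<Delta> x. \<sigma> (t + k) \<omega> = x))"
    unfolding AE_all_countable
  proof (intro allI AE_finite_allI finite)
    fix m :: nat and x s :: "'n \<times> 'n" assume "x \<in> gossip_pairs"
    then show "AE \<omega> in M.
      (\<exists>\<^sub>\<infinity>t. excess (E (\<lambda>s\<in>{1..t}. \<sigma> s \<omega>) s t) (fst x) (snd x) > 1 / Suc m) \<longrightarrow>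
      (\<exists>\<^sub>\<infinity>t. excess (E (\<lambda>s\<in>{1..t}. \<sigma> s \<omega>) s t) (fst x) (snd x) > 1 / Suc m \<and>
        (\<exists>k\<le>\<Delta> x. \<sigma> (t + k) \<omega> = x))"
      by (rule \<Delta>[THEN bspec, THEN spec[where x = "\<lambda>t h. excess (E h s t) (fst x) (snd x) > 1 / Suc m"]])
  qed
  then show ?thesis
    using AE_space
  proof (eventually_elim, intro impI)
    fix \<omega>
    assume hits: "\<forall>m. \<forall>x\<in>gossip_pairs. \<forall>s\<in>UNIV.
      (\<exists>\<^sub>\<infinity>t. excess (E (\<lambda>s\<in>{1..t}. \<sigma> s \<omega>) s t) (fst x) (snd x) > 1 / Suc m) \<longrightarrow>
      (\<exists>\<^sub>\<infinity>t. excess (E (\<lambda>s\<in>{1..t}. \<sigma> s \<omega>) s t) (fst x) (snd x) > 1 / Suc m \<and>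
        (\<exists>k\<le>\<Delta> x. \<sigma> (t + k) \<omega> = x))"
      and \<omega>: "\<omega> \<in> space M" and nd: "nondegenerate Q \<phi> f (\<lambda>t. v t \<omega>)"
    note ev\<omega> = ev[OF \<omega>]
    have part: "v t \<omega> \<in> partitions Q" and step: "v (Suc t) \<omega> = gossip_map Q \<phi> f (\<sigma> t \<omega>) (v t \<omega>)" for t
      using ev\<omega> by (simp_all add: gossip_evolution_def)
    obtain \<epsilon> where pos: "\<epsilon> > 0" and "\<forall>t. regular \<epsilon> (v t \<omega>)"
      using nondegenerate_regular[OF part nd] by (elim exE conjE) (rule that)
    then have reg: "regular \<epsilon> (v t \<omega>)" for t
      by blast
    have \<sigma>: "\<sigma> t \<omega> \<in> gossip_pairs" for t
      using rp measurable_space[OF _ \<omega>, of "\<sigma> t" "count_space gossip_pairs"]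
      by (simp add: randomly_persistent_def)
    \<comment> \<open>With the actual value of \<open>\<sigma> 0\<close> inserted, the partition
      reconstructed from the history is the one on this path.\<close>
    have E: "E (\<lambda>s\<in>{1..t}. \<sigma> s \<omega>) (\<sigma> 0 \<omega>) t = v t \<omega>" for t
    proof -
      have "v t \<omega> = gossip_orbit Q \<phi> f v0 (\<lambda>t. \<sigma> t \<omega>) t"
        using gossip_evolution_orbit[of Q \<phi> f "\<lambda>t. \<sigma> t \<omega>" "\<lambda>t. v t \<omega>" t] ev\<omega> by simp
      also have "\<dots> = E (\<lambda>s\<in>{1..t}. \<sigma> s \<omega>) (\<sigma> 0 \<omega>) t"
        unfolding E_def by (rule gossip_orbit_cong) auto
      finally show ?thesis by simp
    qed
    show "converges_to_set (\<lambda>t. v t \<omega>) (centroidal_voronoi Q \<phi> f)"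
    proof (rule converges_if_excess_tendsto[OF pos reg])
      fix i j :: 'n assume "i \<noteq> j"
      then have x: "(i, j) \<in> gossip_pairs"
        by (simp add: gossip_pairs_def)
      show "(\<lambda>t. excess (v t \<omega>) i j) \<longlonglongrightarrow> 0"
      proof (rule excess_tendstoI[OF reg])
        fix e :: real assume "e > 0"
        then obtain m where m: "1 / real (Suc m) < e"
          using nat_approx_posE by blast
        have m0: "1 / real (Suc m) > 0" by simp
        have soon: "\<forall>\<^sub>F t in sequentially.
            \<forall>k\<le>\<Delta> (i, j). \<sigma> (t + k) \<omega> = (i, j) \<longrightarrow> excess (v t \<omega>) i j \<le> 1 / Suc m"
          by (rule excess_small_before_active[where v = "\<lambda>t. v t \<omega>" and \<sigma> = "\<lambda>t. \<sigma> t \<omega>", OF pos reg \<sigma> step m0])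
        have "\<not> (\<exists>\<^sub>\<infinity>t. excess (v t \<omega>) i j > 1 / Suc m)"
        proof
          assume "\<exists>\<^sub>\<infinity>t. excess (v t \<omega>) i j > 1 / Suc m"
          then have hit: "\<exists>\<^sub>\<infinity>t. excess (v t \<omega>) i j > 1 / Suc m \<and> (\<exists>k\<le>\<Delta> (i, j). \<sigma> (t + k) \<omega> = (i, j))"
            using hits[THEN spec, THEN bspec, OF x, THEN bspec, OF UNIV_I, of m "\<sigma> 0 \<omega>"]
            unfolding E fst_conv snd_conv by (rule rev_mp)
          obtain N where N: "\<forall>t\<ge>N. \<forall>k\<le>\<Delta> (i, j). \<sigma> (t + k) \<omega> = (i, j) \<longrightarrow> excess (v t \<omega>) i j \<le> 1 / Suc m"
            using soon unfolding eventually_sequentially by (elim exE) (rule that)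
          obtain t k where "t \<ge> N" "excess (v t \<omega>) i j > 1 / Suc m" "k \<le> \<Delta> (i, j)" "\<sigma> (t + k) \<omega> = (i, j)"
            using hit unfolding INFM_nat_le by blast
          then show False
            using N[rule_format, of t k] by simp
        qed
        then have "\<forall>\<^sub>F t in sequentially. \<not> excess (v t \<omega>) i j > 1 / Suc m"
          unfolding cofinite_eq_sequentially not_frequently .
        then show "\<forall>\<^sub>F t in sequentially. excess (v t \<omega>) i j \<le> e"
          by eventually_elim (use m in linarith)
      qed
    qed
  qed
qed

end

theorem theorem3p7:
  fixes Q :: "(real^2) set"
    and \<phi> :: "real^2 \<Rightarrow> real"
    and f :: "real \<Rightarrow> real"
  assumes "compact Q" and "convex Q" and "interior Q \<noteq> {}"
    and "CARD('n::finite) \<ge> 2"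
    and "\<And>q. q \<in> Q \<Longrightarrow> \<phi> q > 0"
    and "bounded (\<phi> ` Q)"
    and "\<phi> \<in> borel_measurable (lebesgue_on Q)"
    and "\<And>x. x \<ge> 0 \<Longrightarrow> f x \<ge> 0"
    and "\<And>x. x \<ge> 0 \<Longrightarrow> \<exists>r>0. \<exists>L. L-lipschitz_on (cball x r \<inter> {0..}) f"
    and "strict_mono_on {0..} f"
    and "convex_on {0..} f"
  shows
    "(\<forall>(\<sigma> :: nat \<Rightarrow> 'n \<times> 'n) (v :: nat \<Rightarrow> 'n \<Rightarrow> (real^2) set).
        uniformly_persistent gossip_pairs \<sigma> \<longrightarrow>
        gossip_evolution Q \<phi> f \<sigma> v \<longrightarrow>
        nondegenerate Q \<phi> f v \<longrightarrow>
        converges_to_set v (centroidal_voronoi Q \<phi> f))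
     \<and>
     (\<forall>(M :: 'w measure) (\<sigma> :: nat \<Rightarrow> 'w \<Rightarrow> 'n \<times> 'n)
        (v :: nat \<Rightarrow> 'w \<Rightarrow> 'n \<Rightarrow> (real^2) set) (v0 :: 'n \<Rightarrow> (real^2) set).
        randomly_persistent M gossip_pairs \<sigma> \<longrightarrow>
        (\<forall>\<omega>\<in>space M. v 0 \<omega> = v0 \<and> gossip_evolution Q \<phi> f (\<lambda>t. \<sigma> t \<omega>) (\<lambda>t. v t \<omega>)) \<longrightarrow>
        (AE \<omega> in M. nondegenerate Q \<phi> f (\<lambda>t. v t \<omega>) \<longrightarrow>
           converges_to_set (\<lambda>t. v t \<omega>) (centroidal_voronoi Q \<phi> f)))"
proof -
  obtain B where B: "B > 0" "\<And>q. q \<in> Q \<Longrightarrow> \<phi> q \<le> B"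
    using \<open>bounded (\<phi> ` Q)\<close> unfolding bounded_pos by fastforce
  have "continuous_on {0..} f"
    unfolding continuous_on_eq_continuous_within
  proof
    fix x :: real assume "x \<in> {0..}"
    then obtain r L where "r > 0" "L-lipschitz_on (cball x r \<inter> {0..}) f"
      using assms(9)[of x] by auto
    then have "continuous_on ({0..} \<inter> cball x r) f"
      by (metis Int_commute lipschitz_on_continuous_on)
    then have "continuous (at x within {0..} \<inter> cball x r) f"
      using \<open>x \<in> {0..}\<close> \<open>r > 0\<close> by (simp add: continuous_on_eq_continuous_within)
    moreover have "at x within {0..} \<inter> cball x r = at x within {0..}"
      by (rule at_within_nhd[of x "ball x r"]) (use \<open>r > 0\<close> in auto)
    ultimately show "continuous (at x within {0..}) f"
      by simp
  qed
  then interpret coverage Q \<phi> f B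
    by unfold_locales (use assms B in auto)
  show ?thesis
  proof (intro conjI allI impI)
    fix M :: "'w measure" and \<sigma> :: "nat \<Rightarrow> 'w \<Rightarrow> 'n \<times> 'n"
      and v :: "nat \<Rightarrow> 'w \<Rightarrow> 'n \<Rightarrow> (real^2) set" and v0
    assume "randomly_persistent M gossip_pairs \<sigma>"
      and ev: "\<forall>\<omega>\<in>space M. v 0 \<omega> = v0 \<and> gossip_evolution Q \<phi> f (\<lambda>t. \<sigma> t \<omega>) (\<lambda>t. v t \<omega>)"
    then show "AE \<omega> in M. nondegenerate Q \<phi> f (\<lambda>t. v t \<omega>) \<longrightarrow>
        converges_to_set (\<lambda>t. v t \<omega>) (centroidal_voronoi Q \<phi> f)"
      by (intro randomly_persistent_converges[OF _ bspec[OF ev]])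
  qed (rule uniformly_persistent_converges)
qed

end
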